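(* Let $M_1,M_2$ be positive integers, $\alpha>0$ and $t\ge0$. Let $\tilde\eta_t$ be the one-shock half-line open TASEP with boundary rate $\alpha$ described in the context, let $\mathbf{N}_c(1,t)$ be the number of particles of color $c\in\{1,2\}$ in $\tilde\eta_t$ at sites $\ge1$, and let $\mathcal{N}(x,t)$ be the number of particles at sites $\ge x$ at time $t$ in the standard half-line open TASEP with boundary rate $\alpha$ started from the empty configuration. Then, jointly, $$\big(\mathbf{N}_1(1,t),\mathbf{N}_2(1,t)\big)\stackrel{d}{=}\Big(\mathcal{N}(1,t),\ \min\big\{M_1+M_2+1-\mathcal{N}(1,t)+\mathcal{N}(M_1+M_2+2,t),\ M_2+1\big\}\Big),$$ where $\stackrel{d}{=}$ denotes equality in distribution.
   Context: Multi-color half-line open TASEP: a continuous-time Markov process on configurations $\eta:\mathbb{Z}_{>0}\to\{1,2,+\infty\}$, where $1$ denotes a first-class particle, $2$ a second-class particle and $+\infty$ a hole. Dynamics: independently for each $x\ge1$, at rate $1$ the contents of sites $x$ and $x+1$ are exchanged if $\eta(x)<\eta(x+1)$ (nothing happens otherwise); at rate $\alpha$, if $\eta(1)>1$, the content of site $1$ is replaced by a first-class particle (nothing happens otherwise). In particular, a second-class particle at site $1$ that is replaced in this way leaves the system permanently. Initial condition of $\tilde\eta_t$: $\tilde\eta_0(x)=2$ for $M_1+1\le x\le M_1+M_2+1$ and $\tilde\eta_0(x)=+\infty$ for all other $x\ge1$. $\mathbf{N}_c(x,t)$ is the number of particles of color $c$ in $\tilde\eta_t$ at time $t$ located at sites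 $\ge x$. Standard half-line open TASEP with step initial condition: the same dynamics with only first-class particles and holes, started with all sites of $\mathbb{Z}_{>0}$ empty (holes); $\mathcal{N}(x,t)$ is the number of its particles at sites $\ge x$ at time $t$. *)

theory Defs
  imports "HOL-Probability.Probability"
begin

text \<open>
  A configuration assigns to each site of \<open>{1..}\<close> a colour in \<open>{1, 2, \<infinity>}\<close>: a first-class particle,
  a second-class particle, or a hole. The state space carries the product sigma-algebra; its
  elements are extensional, so \<open>0\<close> is not a site.
\<close>

type_synonym config = "nat \<Rightarrow> enat"

definition configs :: "config measure" where
  "configs = PiM {1..} (\<lambda>_. count_space {1, 2, \<infinity>})"

definition exchange :: "nat \<Rightarrow> config \<Rightarrow> config" where
  "exchange x \<eta> = (if \<eta> x < \<eta> (x + 1) then \<eta>(x := \<eta> (x + 1), x + 1 := \<eta> x) else \<eta>)"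

definition inject :: "config \<Rightarrow> config" where
  "inject \<eta> = (if \<eta> 1 > 1 then \<eta>(1 := 1) else \<eta>)"

definition local_fun :: "(config \<Rightarrow> real) \<Rightarrow> bool" where
  "local_fun f \<longleftrightarrow> (\<exists>A. finite A \<and> A \<subseteq> {1..} \<and>
     (\<forall>\<eta>\<in>space configs. \<forall>\<zeta>\<in>space configs. (\<forall>x\<in>A. \<eta> x = \<zeta> x) \<longrightarrow> f \<eta> = f \<zeta>))"

text \<open>
  The generator on local functions; for such functions only finitely many terms of the sum are
  nonzero.
\<close>

definition tasep_generator :: "real \<Rightarrow> (config \<Rightarrow> real) \<Rightarrow> config \<Rightarrow> real" where
  "tasep_generator \<alpha> f \<eta> =
     \<alpha> * (f (inject \<eta>) - f \<eta>) + (\<Sum>\<^sub>\<infinity>x\<in>{1..}. f (exchange x \<eta>) - f \<eta>)"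

text \<open>
  The Markov transition function of the dynamics: a semigroup of probability kernels on the full
  state space whose derivative at time \<open>0\<close>, in supremum norm, is the generator on every local
  function. As the interaction has finite range and bounded rates, the local functions form a core
  and these conditions determine the kernels.
\<close>

definition tasep_transition :: "real \<Rightarrow> (real \<Rightarrow> config \<Rightarrow> config measure) \<Rightarrow> bool" where
  "tasep_transition \<alpha> P \<longleftrightarrow>
     (\<forall>t\<ge>0. P t \<in> configs \<rightarrow>\<^sub>M prob_algebra configs) \<and>
     (\<forall>\<eta>\<in>space configs. P 0 \<eta> = return configs \<eta>) \<and>
     (\<forall>s\<ge>0. \<forall>t\<ge>0. \<forall>\<eta>\<in>space configs. P (s + t) \<eta> = P s \<eta> \<bind> P t) \<and>
     (\<forall>f. local_fun f \<longrightarrow>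
        uniform_limit (space configs)
          (\<lambda>h \<eta>. ((\<integral>\<zeta>. f \<zeta> \<partial>P h \<eta>) - f \<eta>) / h) (tasep_generator \<alpha> f) (at_right 0))"

definition history :: "'w measure \<Rightarrow> (real \<Rightarrow> 'w \<Rightarrow> config) \<Rightarrow> real \<Rightarrow> 'w measure" where
  "history M X s =
     sigma (space M) {X u -` A \<inter> space M | u A. 0 \<le> u \<and> u \<le> s \<and> A \<in> sets configs}"

text \<open>
  \<open>X\<close>, defined on the probability space \<open>M\<close> and indexed by times \<open>t \<ge> 0\<close>, is the half-line open
  TASEP with boundary rate \<open>\<alpha>\<close> started from \<open>\<eta>\<^sub>0\<close>.
\<close>

definition half_line_tasep ::
  "real \<Rightarrow> config \<Rightarrow> 'w measure \<Rightarrow> (real \<Rightarrow> 'w \<Rightarrow> config) \<Rightarrow> bool" where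
  "half_line_tasep \<alpha> \<eta>\<^sub>0 M X \<longleftrightarrow>
     prob_space M \<and>
     (\<forall>t\<ge>0. X t \<in> M \<rightarrow>\<^sub>M configs) \<and>
     (AE \<omega> in M. X 0 \<omega> = \<eta>\<^sub>0) \<and>
     (\<exists>P. tasep_transition \<alpha> P \<and>
        (\<forall>s\<ge>0. \<forall>t\<ge>0. \<forall>A\<in>sets configs.
           AE \<omega> in M. real_cond_exp M (history M X s) (indicator (X (s + t) -` A \<inter> space M)) \<omega>
             = measure (P t (X s \<omega>)) A))"

text \<open>
  Started from the empty configuration, the dynamics only involves first-class particles and holes.
\<close>

definition empty_config :: config where
  "empty_config = (\<lambda>x\<in>{1..}. \<infinity>)"

definition one_shock_config :: "nat \<Rightarrow> nat \<Rightarrow> config" where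
  "one_shock_config M\<^sub>1 M\<^sub>2 = (\<lambda>x\<in>{1..}. if M\<^sub>1 + 1 \<le> x \<and> x \<le> M\<^sub>1 + M\<^sub>2 + 1 then 2 else \<infinity>)"

text \<open>
  The number of particles of colour \<open>c\<close> at sites \<open>\<ge> x\<close>. From the initial conditions above it is
  almost surely finite at every fixed time, so the value of \<open>card\<close> on infinite sets is immaterial.
\<close>

definition num_particles :: "enat \<Rightarrow> nat \<Rightarrow> config \<Rightarrow> nat" where
  "num_particles c x \<eta> = card {y \<in> {1..}. x \<le> y \<and> \<eta> y = c}"

end

theory Submission
  imports Defs
begin

text \<open>
  The proof is a Markov duality. For a configuration \<open>\<eta>\<close> and \<open>c \<in> {1, 2}\<close> let \<open>A\<^sub>c \<eta> b\<close> be the number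
  of particles of colour at most \<open>c\<close> at sites \<open>> b\<close>. An exchange across the bond \<open>(x, x + 1)\<close> turns
  \<open>A\<^sub>c \<eta> x\<close> into the minimum of \<open>A\<^sub>c \<eta> (x - 1)\<close> and \<open>A\<^sub>c \<eta> (x + 1) + 1\<close>, and an injection turns
  \<open>A\<^sub>c \<eta> 0\<close> into \<open>A\<^sub>c \<eta> 1 + 1\<close>. Either move, applied to \<open>\<eta>\<close> or to \<open>\<zeta>\<close>, just removes the term
  \<open>b = x\<close> (respectively \<open>b = 0\<close>) from \<open>H\<^sub>c \<eta> \<zeta> = (MIN b. A\<^sub>c \<eta> b + A\<^sub>1 \<zeta> b + b)\<close>. Hence the pair
  \<open>(H\<^sub>1, H\<^sub>2)\<close> is a duality function for two copies of the process. Pairing \<open>\<eta>\<^sub>t\<close> with the empty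
  configuration gives \<open>(\<^bold>N\<^sub>1, \<^bold>N\<^sub>1 + \<^bold>N\<^sub>2)\<close>, and pairing the one-shock configuration with \<open>\<zeta>\<^sub>t\<close> gives
  the right-hand side of the theorem.

  The transition function is only known through its generator on local functions, so the duality is
  applied to the restriction to the first \<open>n\<close> sites. The error comes from the bond \<open>(n, n + 1)\<close> alone
  and is controlled by the expectation of \<open>\<Sum>x. 2\<^sup>x 1[\<eta> x \<noteq> \<infinity>]\<close>, which grows at most exponentially in
  time.
\<close>

section \<open>The duality function\<close>

text \<open>This is \<open>A\<^sub>c\<close> of the overview cut off at site \<open>n\<close>, so
  that everything built from it is local. The argument \<open>b\<close> labels the bond between the
  sites \<open>b\<close> and \<open>b + 1\<close>, with \<open>b = 0\<close> the boundary.\<close>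

definition occ :: "nat \<Rightarrow> enat \<Rightarrow> config \<Rightarrow> nat \<Rightarrow> nat" where
  "occ n c \<eta> b = (\<Sum>y\<in>{b<..n}. of_bool (\<eta> y \<le> c))"

lemma occ_step: "b < n \<Longrightarrow> occ n c \<eta> b = of_bool (\<eta> (b + 1) \<le> c) + occ n c \<eta> (b + 1)"
proof -
  assume "b < n"
  then have "{b<..n} = insert (b + 1) {b + 1<..n}" by auto
  then show ?thesis by (simp add: occ_def)
qed

lemma occ_le: "b < n \<Longrightarrow> occ n c \<eta> b \<le> occ n c \<eta> (b + 1) + 1"
  "b < n \<Longrightarrow> occ n c \<eta> (b + 1) \<le> occ n c \<eta> b"
  by (simp_all add: occ_step[of b])

lemma occ_cong: "(\<And>y. b < y \<Longrightarrow> y \<le> n \<Longrightarrow> \<eta> y = \<zeta> y) \<Longrightarrow> occ n c \<eta> b = occ n c \<zeta> b"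
  unfolding occ_def by (intro sum.cong) auto

text \<open>After an attempted exchange the smaller of the two contents sits at
  \<open>x + 1\<close>. Hence the count at \<open>x\<close> exceeds the count at
  \<open>x + 1\<close> by one as soon as either site holds a colour at most \<open>c\<close>, which
  is the stated minimum; a blocked exchange obeys the same formula. All other counts see both sites
  or neither.\<close>

lemma occ_exchange:
  assumes "1 \<le> x" "x < n" "b \<le> n"
  shows "occ n c (exchange x \<eta>) b =
    (if b = x then min (occ n c \<eta> (x - 1)) (occ n c \<eta> (x + 1) + 1) else occ n c \<eta> b)"
proof -
  obtain w where x: "x = Suc w" using assms(1) by (cases x) auto
  have right: "occ n c (exchange x \<eta>) b = occ n c \<eta> b" if "x < b" for b
    using that by (intro occ_cong) (auto simp: exchange_def)
  have at: "occ n c (exchange x \<eta>) x = min (occ n c \<eta> w) (occ n c \<eta> (x + 1) + 1)"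
    using assms right[of "x + 1"] occ_step[of w n c \<eta>] occ_step[of x n c \<eta>]
      occ_step[of x n c "exchange x \<eta>"] x
    by (auto simp: exchange_def min_def)
  have before: "occ n c (exchange x \<eta>) w = occ n c \<eta> w"
    using assms right[of "x + 1"] occ_step[of w n c \<eta>] occ_step[of x n c \<eta>]
      occ_step[of x n c "exchange x \<eta>"] occ_step[of w n c "exchange x \<eta>"] x
    by (auto simp: exchange_def)
  have left: "occ n c (exchange x \<eta>) b = occ n c \<eta> b" if "b \<le> w" for b
    using that
  proof (induction rule: inc_induct)
    case (step m)
    then show ?case
      using assms x occ_step[of m n c \<eta>] occ_step[of m n c "exchange x \<eta>"]
      by (auto simp: exchange_def)
  qed (rule before)
  show ?thesis using at left[of b] right[of b] x by (cases b x rule: linorder_cases) auto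
qed

text \<open>Site \<open>1\<close> has content at most \<open>1\<close> after \<open>inject\<close>,
  whether or not it was changed, so it counts for every \<open>c \<ge> 1\<close>.\<close>

lemma occ_inject:
  assumes "1 \<le> n" "1 \<le> c" "b \<le> n"
  shows "occ n c (inject \<eta>) b = (if b = 0 then occ n c \<eta> 1 + 1 else occ n c \<eta> b)"
proof -
  have right: "occ n c (inject \<eta>) b = occ n c \<eta> b" if "0 < b" for b
    using that by (intro occ_cong) (auto simp: inject_def)
  then show ?thesis
    using assms occ_step[of 0 n c "inject \<eta>"] right[of 1] by (auto simp: inject_def one_enat_def)
qed

text \<open>A min-plus pairing of two counting functions; applied to \<open>occ n c \<eta>\<close>
  and \<open>occ n 1 \<zeta>\<close> it is \<open>H\<^sub>c\<close> of the overview on the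
  window.\<close>

definition overlap :: "nat \<Rightarrow> (nat \<Rightarrow> nat) \<Rightarrow> (nat \<Rightarrow> nat) \<Rightarrow> nat" where
  "overlap n A B = (MIN b\<in>{..n}. A b + B b + b)"

lemma overlap_commute: "overlap n A B = overlap n B A"
  by (simp add: overlap_def add.commute)

lemma Min_remove_dominated:
  fixes f :: "nat \<Rightarrow> nat"
  assumes "finite S" "x \<in> S" "y \<in> S" "y \<noteq> x" "f y \<le> f x"
  shows "Min (f ` S) = Min (f ` (S - {x}))"
proof -
  have "f ` S = insert (f x) (f ` (S - {x}))" using assms by auto
  moreover have "Min (f ` (S - {x})) \<le> f x"
    using assms by (intro order_trans[OF Min_le[of _ "f y"]]) auto
  moreover have "f ` (S - {x}) \<noteq> {}" using assms by auto
  ultimately show ?thesis using assms(1) by (metis Min_insert finite_Diff finite_imageI min.absorb2)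
qed

text \<open>The new term at \<open>x\<close> is at least as large as a neighbouring one: the term at
  \<open>x - 1\<close> if the minimum is \<open>A (x - 1)\<close>, because
  \<open>B (x - 1) \<le> B x + 1\<close>, and the term at \<open>x + 1\<close> otherwise, because
  \<open>B (x + 1) \<le> B x\<close>. So it drops out.\<close>

lemma overlap_flip:
  assumes "1 \<le> x" "x < n" "B x \<le> B (x - 1)" "B (x - 1) \<le> B x + 1" "B (x + 1) \<le> B x"
  shows "overlap n (\<lambda>b. if b = x then min (A (x - 1)) (A (x + 1) + 1) else A b) B
    = (MIN b\<in>{..n} - {x}. A b + B b + b)"
proof -
  let ?f = "\<lambda>b. (if b = x then min (A (x - 1)) (A (x + 1) + 1) else A b) + B b + b"
  have "?f (x - 1) \<le> ?f x \<or> ?f (x + 1) \<le> ?f x" using assms by auto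
  moreover have "x - 1 \<in> {..n}" "x - 1 \<noteq> x" "x + 1 \<in> {..n}" "x + 1 \<noteq> x" using assms by auto
  ultimately obtain y where "y \<in> {..n}" "y \<noteq> x" "?f y \<le> ?f x" by blast
  then have "Min (?f ` {..n}) = Min (?f ` ({..n} - {x}))"
    using assms by (intro Min_remove_dominated[where y = y]) auto
  also have "?f ` ({..n} - {x}) = (\<lambda>b. A b + B b + b) ` ({..n} - {x})" by (intro image_cong) auto
  finally show ?thesis by (simp add: overlap_def)
qed

lemma overlap_cong: "(\<And>b. b \<le> n \<Longrightarrow> A b = A' b) \<Longrightarrow> (\<And>b. b \<le> n \<Longrightarrow> B b = B' b)
   \<Longrightarrow> overlap n A B = overlap n A' B'"
  unfolding overlap_def by (intro arg_cong[where f = Min] image_cong) auto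

text \<open>Both sides equal the minimum over \<open>b \<noteq> x\<close>, which is symmetric in the
  two configurations. The bond \<open>(n, n + 1)\<close> is excluded: \<open>occ n\<close> does not
  see site \<open>n + 1\<close>.\<close>

lemma overlap_exchange:
  assumes "1 \<le> x" "x < n"
  shows "overlap n (occ n c (exchange x \<eta>)) (occ n d \<zeta>) = overlap n (occ n c \<eta>) (occ n d (exchange x \<zeta>))"
proof -
  have "overlap n (occ n c (exchange x \<eta>)) (occ n d \<zeta>) = (MIN b\<in>{..n} - {x}. occ n c \<eta> b + occ n d \<zeta> b + b)"
    for c d \<eta> \<zeta>
    using assms occ_le[of "x - 1" n d \<zeta>] occ_le[of x n d \<zeta>]
    by (subst overlap_flip[symmetric]) (auto intro!: overlap_cong simp: occ_exchange)
  from this[of c \<eta> d \<zeta>] this[of d \<zeta> c \<eta>] show ?thesis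
    by (simp add: overlap_commute[of n "occ n c \<eta>"] add.commute)
qed

lemma overlap_inject:
  assumes "1 \<le> n" "1 \<le> c" "1 \<le> d"
  shows "overlap n (occ n c (inject \<eta>)) (occ n d \<zeta>) = overlap n (occ n c \<eta>) (occ n d (inject \<zeta>))"
proof -
  have "overlap n (occ n c (inject \<eta>)) (occ n d \<zeta>) = (MIN b\<in>{..n} - {0}. occ n c \<eta> b + occ n d \<zeta> b + b)"
    if "1 \<le> c" for c d \<eta> \<zeta>
  proof -
    let ?f = "\<lambda>b. occ n c (inject \<eta>) b + occ n d \<zeta> b + b"
    \<comment> \<open>The term at \<open>0\<close> is now
      \<open>occ n c \<eta> 1 + 1 + occ n d \<zeta> 0\<close>, which is no smaller than the term at
      \<open>1\<close>.\<close>
    have "Min (?f ` {..n}) = Min (?f ` ({..n} - {0}))"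
      using assms that occ_le(2)[of 0 n d \<zeta>]
      by (intro Min_remove_dominated[where y = 1]) (auto simp: occ_inject)
    also have "?f ` ({..n} - {0}) = (\<lambda>b. occ n c \<eta> b + occ n d \<zeta> b + b) ` ({..n} - {0})"
      using assms that by (intro image_cong) (auto simp: occ_inject)
    finally show ?thesis by (simp add: overlap_def)
  qed
  from this[of c \<eta> d \<zeta>] this[of d \<zeta> c \<eta>] assms show ?thesis
    by (simp add: overlap_commute[of n "occ n c \<eta>"] add.commute)
qed

section \<open>Local functions\<close>

lemma space_configs: "space configs = PiE {1..} (\<lambda>_. {1, 2, \<infinity>})"
  by (simp add: configs_def space_PiM)

lemma in_configs_iff:
  "\<eta> \<in> space configs \<longleftrightarrow> \<eta> 0 = undefined \<and> (\<forall>x\<ge>1. \<eta> x \<in> {1, 2, \<infinity>})"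
proof -
  have "(\<forall>x. \<not> 1 \<le> x \<longrightarrow> \<eta> x = undefined) \<longleftrightarrow> \<eta> 0 = undefined"
    by (metis less_one linorder_not_less)
  then show ?thesis
    unfolding space_configs PiE_iff extensional_def atLeast_iff mem_Collect_eq Ball_def by blast
qed

lemma config_values: "\<eta> \<in> space configs \<Longrightarrow> 1 \<le> x \<Longrightarrow> \<eta> x = 1 \<or> \<eta> x = 2 \<or> \<eta> x = \<infinity>"
  by (drule in_configs_iff[THEN iffD1], drule conjunct2, drule spec[of _ x]) simp

lemma exchange_in_configs:
  assumes "\<eta> \<in> space configs" "1 \<le> x"
  shows "exchange x \<eta> \<in> space configs"
proof -
  have "exchange x \<eta> 0 = \<eta> 0" using assms(2) by (simp add: exchange_def)
  moreover have "exchange x \<eta> y \<in> {1, 2, \<infinity>}" if "1 \<le> y" for y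
  proof -
    have "exchange x \<eta> y = \<eta> x \<or> exchange x \<eta> y = \<eta> (x + 1) \<or> exchange x \<eta> y = \<eta> y"
      by (simp add: exchange_def)
    then show ?thesis
      using config_values[OF assms(1), of x] config_values[OF assms(1), of "x + 1"]
        config_values[OF assms(1) that] assms(2)
      by (elim disjE) simp_all
  qed
  ultimately show ?thesis using assms(1) by (simp add: in_configs_iff)
qed

lemma inject_in_configs: "\<eta> \<in> space configs \<Longrightarrow> inject \<eta> \<in> space configs"
  unfolding in_configs_iff inject_def by simp

lemma site_pred_measurable [measurable]:
  assumes "1 \<le> x"
  shows "{\<eta> \<in> space configs. Q (\<eta> x)} \<in> sets configs"
proof -
  have "(\<lambda>\<eta>. \<eta> x) \<in> configs \<rightarrow>\<^sub>M count_space {1, 2, \<infinity>}"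
    unfolding configs_def using assms by (intro measurable_component_singleton) auto
  from measurable_sets[OF this, of "{1, 2, \<infinity>} \<inter> Collect Q"]
  have "(\<lambda>\<eta>. \<eta> x) -` ({1, 2, \<infinity>} \<inter> Collect Q) \<inter> space configs \<in> sets configs" by auto
  also have "(\<lambda>\<eta>. \<eta> x) -` ({1, 2, \<infinity>} \<inter> Collect Q) \<inter> space configs = {\<eta> \<in> space configs. Q (\<eta> x)}"
    using config_values[OF _ assms] by blast
  finally show ?thesis .
qed

text \<open>Locality with an explicit window \<open>{1..n}\<close>: the generator enlarges the
  window by one site, and the duality error is estimated in terms of \<open>n\<close>.\<close>

definition depends_on_first :: "nat \<Rightarrow> (config \<Rightarrow> real) \<Rightarrow> bool" where
  "depends_on_first n f \<longleftrightarrow> (\<forall>\<eta>\<in>space configs. \<forall>\<zeta>\<in>space configs.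
     (\<forall>x\<in>{1..n}. \<eta> x = \<zeta> x) \<longrightarrow> f \<eta> = f \<zeta>)"

lemma depends_on_firstD:
  "depends_on_first n f \<Longrightarrow> \<eta> \<in> space configs \<Longrightarrow> \<zeta> \<in> space configs \<Longrightarrow>
    (\<And>x. 1 \<le> x \<Longrightarrow> x \<le> n \<Longrightarrow> \<eta> x = \<zeta> x) \<Longrightarrow> f \<eta> = f \<zeta>"
  unfolding depends_on_first_def by (metis atLeastAtMost_iff)

lemma depends_on_first_local: "depends_on_first n f \<Longrightarrow> local_fun f"
  unfolding local_fun_def depends_on_first_def
  by (rule exI[of _ "{1..n}"], intro conjI, simp, simp add: subset_eq, assumption)

section \<open>Expansion of local functions over cylinder events\<close>

definition truncate_config :: "nat \<Rightarrow> config \<Rightarrow> config" where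
  "truncate_config n \<eta> = (\<lambda>x\<in>{1..}. if x \<le> n then \<eta> x else \<infinity>)"

lemma truncate_in_configs: "\<eta> \<in> space configs \<Longrightarrow> truncate_config n \<eta> \<in> space configs"
  unfolding in_configs_iff truncate_config_def by simp

lemma truncate_eq_iff: "truncate_config n \<eta> = truncate_config n \<zeta> \<longleftrightarrow> (\<forall>x\<in>{1..n}. \<eta> x = \<zeta> x)"
  by (auto simp: truncate_config_def fun_eq_iff restrict_def)

lemma depends_on_first_truncate:
  "depends_on_first n f \<Longrightarrow> \<eta> \<in> space configs \<Longrightarrow> f (truncate_config n \<eta>) = f \<eta>"
  by (erule depends_on_firstD) (auto simp: truncate_in_configs, auto simp: truncate_config_def)

lemma finite_truncate: "finite (truncate_config n ` space configs)"
proof (rule finite_subset)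
  show "truncate_config n ` space configs \<subseteq>
    (\<lambda>g. \<lambda>x\<in>{1..}. if x \<le> n then g x else \<infinity>) ` PiE {1..n} (\<lambda>_. {1, 2, \<infinity>})"
  proof safe
    fix \<eta> assume "\<eta> \<in> space configs"
    then have "restrict \<eta> {1..n} \<in> PiE {1..n} (\<lambda>_. {1, 2, \<infinity>})"
      unfolding in_configs_iff by (intro restrict_PiE_iff[THEN iffD2]) simp
    moreover have "truncate_config n \<eta> = (\<lambda>x\<in>{1..}. if x \<le> n then restrict \<eta> {1..n} x else \<infinity>)"
      by (auto simp: truncate_config_def fun_eq_iff restrict_def)
    ultimately show "truncate_config n \<eta> \<in>
      (\<lambda>g. \<lambda>x\<in>{1..}. if x \<le> n then g x else \<infinity>) ` PiE {1..n} (\<lambda>_. {1, 2, \<infinity>})" by blast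
  qed
qed (auto intro!: finite_imageI finite_PiE)

text \<open>Truncations represent the finitely many classes of configurations agreeing on the first
  \<open>n\<close> sites. A function of these sites is thus a finite combination of class
  indicators, which gives measurability and, later, separates the two arguments of the duality
  function.\<close>

lemma depends_on_first_expand:
  assumes "depends_on_first n f" "\<eta> \<in> space configs"
  shows "f \<eta> = (\<Sum>a\<in>truncate_config n ` space configs. f a * of_bool (truncate_config n \<eta> = a))"
proof -
  have "(\<Sum>a\<in>truncate_config n ` space configs. f a * of_bool (truncate_config n \<eta> = a))
      = (\<Sum>a\<in>truncate_config n ` space configs. if a = truncate_config n \<eta> then f a else 0)"
    by (intro sum.cong) auto
  also have "\<dots> = f (truncate_config n \<eta>)" using assms by (simp add: finite_truncate)
  finally show ?thesis using depends_on_first_truncate[OF assms] by simp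
qed

lemma depends_on_first_of_bool_truncate:
  "depends_on_first n (\<lambda>\<eta>. of_bool (truncate_config n \<eta> = a))"
  unfolding depends_on_first_def using truncate_eq_iff by metis

lemma measurable_truncate_eq:
  assumes "a \<in> truncate_config n ` space configs"
  shows "{\<eta> \<in> space configs. truncate_config n \<eta> = a} \<in> sets configs"
proof -
  obtain \<zeta> where "a = truncate_config n \<zeta>" using assms by auto
  then have "{\<eta> \<in> space configs. truncate_config n \<eta> = a} = {\<eta> \<in> space configs. \<forall>x\<in>{1..n}. \<eta> x = \<zeta> x}"
    by (auto simp: truncate_eq_iff)
  also have "\<dots> \<in> sets configs" by (intro sets.sets_Collect_finite_All) auto
  finally show ?thesis .
qed

lemma depends_on_first_measurable:
  assumes "depends_on_first n f"
  shows "f \<in> borel_measurable configs"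
proof -
  have "(\<lambda>\<eta>. of_bool (truncate_config n \<eta> = a) :: real) \<in> borel_measurable configs"
    if "a \<in> truncate_config n ` space configs" for a
  proof (subst measurable_cong)
    show "of_bool (truncate_config n \<eta> = a) = indicator {\<eta> \<in> space configs. truncate_config n \<eta> = a} \<eta>"
      if "\<eta> \<in> space configs" for \<eta> using that by (auto simp: indicator_def)
    show "(indicator {\<eta> \<in> space configs. truncate_config n \<eta> = a} :: _ \<Rightarrow> real) \<in> borel_measurable configs"
      using measurable_truncate_eq[OF that] by simp
  qed
  then have "(\<lambda>\<eta>. \<Sum>a\<in>truncate_config n ` space configs. f a * of_bool (truncate_config n \<eta> = a))
      \<in> borel_measurable configs"
    by (intro borel_measurable_sum borel_measurable_times) auto
  then show ?thesis
    by (subst measurable_cong[OF depends_on_first_expand[OF assms]])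
qed

lemma depends_on_first_bounded:
  assumes "depends_on_first n f"
  obtains B where "\<And>\<eta>. \<eta> \<in> space configs \<Longrightarrow> \<bar>f \<eta>\<bar> \<le> B"
proof (rule that)
  fix \<eta> assume \<eta>: "\<eta> \<in> space configs"
  then have "\<bar>f (truncate_config n \<eta>)\<bar> \<le> (\<Sum>a\<in>truncate_config n ` space configs. \<bar>f a\<bar>)"
    by (intro member_le_sum) (auto simp: finite_truncate)
  then show "\<bar>f \<eta>\<bar> \<le> (\<Sum>a\<in>truncate_config n ` space configs. \<bar>f a\<bar>)"
    using depends_on_first_truncate[OF assms \<eta>] by simp
qed

lemma depends_on_first_integrable:
  assumes "prob_space \<mu>" "sets \<mu> = sets configs" "depends_on_first n f"
  shows "integrable \<mu> f"
proof -
  interpret prob_space \<mu> by fact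
  obtain B where "\<And>\<zeta>. \<zeta> \<in> space configs \<Longrightarrow> \<bar>f \<zeta>\<bar> \<le> B"
    using depends_on_first_bounded[OF assms(3)] by blast
  moreover have "f \<in> borel_measurable \<mu>"
    using depends_on_first_measurable[OF assms(3)] assms(2) by (simp cong: measurable_cong_sets)
  ultimately show ?thesis
    using sets_eq_imp_space_eq[OF assms(2)] by (intro integrable_const_bound[of _ B]) auto
qed

section \<open>The generator on functions of finitely many sites\<close>

lemma depends_on_first_exchange_beyond:
  assumes "depends_on_first n f" "\<eta> \<in> space configs" "1 \<le> x" "n < x"
  shows "f (exchange x \<eta>) = f \<eta>"
  using assms by (intro depends_on_firstD[of n f]) (auto simp: exchange_in_configs, auto simp: exchange_def)

text \<open>Bonds beyond \<open>n\<close> leave the first \<open>n\<close> sites alone. The bond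
  \<open>(n, n + 1)\<close> stays in the sum, since it can change site \<open>n\<close>.\<close>

lemma tasep_generator_eq:
  assumes "depends_on_first n f" "\<eta> \<in> space configs"
  shows "tasep_generator \<alpha> f \<eta> =
    \<alpha> * (f (inject \<eta>) - f \<eta>) + (\<Sum>x=1..n. f (exchange x \<eta>) - f \<eta>)"
proof -
  have "(\<Sum>\<^sub>\<infinity>x\<in>{1..}. f (exchange x \<eta>) - f \<eta>) = (\<Sum>\<^sub>\<infinity>x\<in>{1..n}. f (exchange x \<eta>) - f \<eta>)"
    using depends_on_first_exchange_beyond[OF assms] by (intro infsum_cong_neutral) auto
  then show ?thesis by (simp add: tasep_generator_def)
qed

text \<open>The extra site is the one read by the exchange across the bond
  \<open>(n, n + 1)\<close>.\<close>

lemma depends_on_first_generator: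
  assumes "depends_on_first n f"
  shows "depends_on_first (n + 1) (tasep_generator \<alpha> f)"
  unfolding depends_on_first_def
proof (intro ballI impI)
  fix \<eta> \<zeta> assume \<eta>: "\<eta> \<in> space configs" and \<zeta>: "\<zeta> \<in> space configs"
    and eq: "\<forall>x\<in>{1..n + 1}. \<eta> x = \<zeta> x"
  have "f \<eta> = f \<zeta>" using eq by (intro depends_on_firstD[OF assms \<eta> \<zeta>]) auto
  moreover have "f (inject \<eta>) = f (inject \<zeta>)"
    using eq by (intro depends_on_firstD[OF assms] inject_in_configs \<eta> \<zeta>) (auto simp: inject_def)
  moreover have "f (exchange x \<eta>) = f (exchange x \<zeta>)" if "x \<in> {1..n}" for x
    using eq that
    by (intro depends_on_firstD[OF assms] exchange_in_configs \<eta> \<zeta>) (auto simp: exchange_def)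
  ultimately show "tasep_generator \<alpha> f \<eta> = tasep_generator \<alpha> f \<zeta>"
    unfolding tasep_generator_eq[OF assms \<eta>] tasep_generator_eq[OF assms \<zeta>]
    by (intro arg_cong2[of _ _ _ _ "(+)"] sum.cong) auto
qed

section \<open>Differentiability from uniform forward differences\<close>

lemma has_real_derivative_of_uniform_steps:
  fixes u v :: "real \<Rightarrow> real"
  assumes step: "\<And>e. e > 0 \<Longrightarrow> \<exists>d>0. \<forall>s\<ge>0. \<forall>h. 0 < h \<longrightarrow> h < d \<longrightarrow> \<bar>u (s + h) - u s - h * v s\<bar> \<le> e * h"
    and cont: "continuous_on {0..} v" and s: "0 \<le> s"
  shows "(u has_real_derivative v s) (at s within {0..})"
  unfolding has_field_derivative_iff Lim_within
proof (intro allI impI)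
  fix e :: real assume "e > 0"
  then obtain d where d: "d > 0"
    "\<And>s h. 0 \<le> s \<Longrightarrow> 0 < h \<Longrightarrow> h < d \<Longrightarrow> \<bar>u (s + h) - u s - h * v s\<bar> \<le> e / 2 / 2 * h"
    using step[of "e / 2 / 2"] by auto
  obtain d' where d': "d' > 0" "\<And>y. 0 \<le> y \<Longrightarrow> \<bar>y - s\<bar> < d' \<Longrightarrow> \<bar>v y - v s\<bar> < e / 2"
    using cont s \<open>e > 0\<close> unfolding continuous_on_iff dist_real_def
    by (metis atLeast_iff half_gt_zero)
  have "\<bar>(u y - u s) / (y - s) - v s\<bar> < e" if y: "0 \<le> y" "y \<noteq> s" "\<bar>y - s\<bar> < min d d'" for y
  proof (cases "s < y")
    case True
    have "\<bar>u y - u s - (y - s) * v s\<bar> \<le> e / 2 / 2 * (y - s)"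
      using d(2)[of s "y - s"] True s y by simp
    moreover have "(u y - u s) / (y - s) - v s = (u y - u s - (y - s) * v s) / (y - s)"
      using True by (simp add: field_simps)
    ultimately have "\<bar>(u y - u s) / (y - s) - v s\<bar> \<le> e / 2 / 2"
      using True by (simp add: abs_divide pos_divide_le_eq)
    then show ?thesis using \<open>e > 0\<close> by simp
  next
    case False
    then have less: "y < s" using y by simp
    \<comment> \<open>The backward quotient at \<open>s\<close> is a forward quotient started at
      \<open>y\<close>, hence close to \<open>v y\<close>; continuity of \<open>v\<close> then
      replaces \<open>v y\<close> by \<open>v s\<close>.\<close>
    have "\<bar>u s - u y - (s - y) * v y\<bar> \<le> e / 2 / 2 * (s - y)"
      using d(2)[of y "s - y"] less y by simp
    moreover have "(u y - u s) / (y - s) - v y = (u s - u y - (s - y) * v y) / (s - y)"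
      using less by (simp add: field_simps)
    ultimately have "\<bar>(u y - u s) / (y - s) - v y\<bar> \<le> e / 2 / 2"
      using less by (simp add: abs_divide pos_divide_le_eq)
    moreover have "\<bar>v y - v s\<bar> < e / 2" using d'(2) y by simp
    ultimately show ?thesis using \<open>e > 0\<close> by linarith
  qed
  then show "\<exists>d>0. \<forall>y\<in>{0..}. 0 < dist y s \<and> dist y s < d \<longrightarrow>
      dist ((u y - u s) / (y - s)) (v s) < e"
    using d(1) d'(1) by (intro exI[of _ "min d d'"]) (auto simp: dist_real_def)
qed

text \<open>With slopes bounded by \<open>B\<close> and an error of at most \<open>h\<close>, an
  increment over a short time \<open>h\<close> is at most \<open>h * (B + 1)\<close>, uniformly in
  the starting time.\<close>

lemma continuous_on_of_uniform_steps:
  fixes u v :: "real \<Rightarrow> real"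
  assumes step: "\<And>e. e > 0 \<Longrightarrow> \<exists>d>0. \<forall>s\<ge>0. \<forall>h. 0 < h \<longrightarrow> h < d \<longrightarrow> \<bar>u (s + h) - u s - h * v s\<bar> \<le> e * h"
    and bound: "\<And>s. 0 \<le> s \<Longrightarrow> \<bar>v s\<bar> \<le> B"
  shows "continuous_on {0..} u"
  unfolding continuous_on_iff
proof (intro ballI allI impI)
  fix s e :: real assume "s \<in> {0..}" "e > 0"
  obtain d where d: "d > 0"
    "\<And>s h. 0 \<le> s \<Longrightarrow> 0 < h \<Longrightarrow> h < d \<Longrightarrow> \<bar>u (s + h) - u s - h * v s\<bar> \<le> h"
    using step[of 1] by auto
  have B: "B \<ge> 0" using bound[of 0] by simp
  have near: "\<bar>u (r + h) - u r\<bar> < e" if "0 \<le> r" "0 < h" "h < min d (e / (B + 1))" for r h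
  proof -
    have "\<bar>h * v r\<bar> \<le> h * B" using bound[of r] that by (simp add: abs_mult)
    then have "\<bar>u (r + h) - u r\<bar> \<le> h * (B + 1)"
      using d(2)[of r h] that by (simp add: algebra_simps)
    also have "\<dots> < e" using that B by (simp add: pos_less_divide_eq)
    finally show ?thesis .
  qed
  have "\<bar>u y - u s\<bar> < e" if "0 \<le> y" "\<bar>y - s\<bar> < min d (e / (B + 1))" for y
    using near[of s "y - s"] near[of y "s - y"] that \<open>s \<in> {0..}\<close> \<open>e > 0\<close>
    by (cases y s rule: linorder_cases) auto
  then show "\<exists>d>0. \<forall>y\<in>{0..}. dist y s < d \<longrightarrow> dist (u y) (u s) < e"
    using d(1) B \<open>e > 0\<close> by (intro exI[of _ "min d (e / (B + 1))"]) (auto simp: dist_real_def)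
qed

section \<open>The forward equation\<close>

locale tasep_kernel =
  fixes \<alpha> :: real and P :: "real \<Rightarrow> config \<Rightarrow> config measure"
  assumes transition: "tasep_transition \<alpha> P"
begin

lemma kernel_measurable: "0 \<le> t \<Longrightarrow> P t \<in> configs \<rightarrow>\<^sub>M prob_algebra configs"
  using transition by (simp add: tasep_transition_def)

lemma
  assumes "0 \<le> t" "\<eta> \<in> space configs"
  shows kernel_prob_space: "prob_space (P t \<eta>)" and sets_kernel: "sets (P t \<eta>) = sets configs"
    and space_kernel: "space (P t \<eta>) = space configs"
proof -
  show *: "prob_space (P t \<eta>)" "sets (P t \<eta>) = sets configs"
    using measurable_space[OF kernel_measurable assms(2)] assms(1) by (auto simp: space_prob_algebra)
  show "space (P t \<eta>) = space configs" using sets_eq_imp_space_eq[OF *(2)] .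
qed

lemma kernel_integrable:
  assumes "0 \<le> t" "\<eta> \<in> space configs" "depends_on_first n f"
  shows "integrable (P t \<eta>) f"
  using assms by (intro depends_on_first_integrable kernel_prob_space sets_kernel)

lemma kernel_integral_bound:
  assumes "0 \<le> t" "\<eta> \<in> space configs" "depends_on_first n f"
    and "\<And>\<zeta>. \<zeta> \<in> space configs \<Longrightarrow> \<bar>f \<zeta>\<bar> \<le> B"
  shows "\<bar>\<integral>\<zeta>. f \<zeta> \<partial>P t \<eta>\<bar> \<le> B"
proof -
  interpret prob_space "P t \<eta>" using assms by (intro kernel_prob_space)
  note int = kernel_integrable[OF assms(1-3)]
  have "(\<integral>\<zeta>. f \<zeta> \<partial>P t \<eta>) \<le> B"
    using int assms(4) space_kernel[OF assms(1,2)] by (intro integral_le_const AE_I2) fastforce+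
  moreover have "- B \<le> (\<integral>\<zeta>. f \<zeta> \<partial>P t \<eta>)"
    using int assms(4) space_kernel[OF assms(1,2)] by (intro integral_ge_const AE_I2) fastforce+
  ultimately show ?thesis by simp
qed

lemma kernel_zero:
  assumes "\<eta> \<in> space configs" "depends_on_first n f"
  shows "(\<integral>\<zeta>. f \<zeta> \<partial>P 0 \<eta>) = f \<eta>"
proof -
  have "P 0 \<eta> = return configs \<eta>" using transition assms(1) by (simp add: tasep_transition_def)
  then show ?thesis using assms depends_on_first_measurable by (simp add: integral_return)
qed

lemma kernel_semigroup:
  assumes "0 \<le> s" "0 \<le> h" "\<eta> \<in> space configs" "depends_on_first n f"
  shows "(\<integral>\<zeta>. f \<zeta> \<partial>P (s + h) \<eta>) = (\<integral>\<xi>. (\<integral>\<zeta>. f \<zeta> \<partial>P h \<xi>) \<partial>P s \<eta>)"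
    and "integrable (P s \<eta>) (\<lambda>\<xi>. \<integral>\<zeta>. f \<zeta> \<partial>P h \<xi>)"
proof -
  interpret prob_space "P s \<eta>" using assms by (intro kernel_prob_space)
  obtain B where B: "\<And>\<zeta>. \<zeta> \<in> space configs \<Longrightarrow> \<bar>f \<zeta>\<bar> \<le> B"
    using depends_on_first_bounded[OF assms(4)] by blast
  have meas: "P h \<in> P s \<eta> \<rightarrow>\<^sub>M subprob_algebra configs"
    using measurable_prob_algebraD[OF kernel_measurable[OF assms(2)]] sets_kernel[OF assms(1,3)]
    by (simp cong: measurable_cong_sets)
  have f: "f \<in> borel_measurable configs" using depends_on_first_measurable[OF assms(4)] .
  have eq: "P (s + h) \<eta> = P s \<eta> \<bind> P h"
    using transition assms by (simp add: tasep_transition_def)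
  show "(\<integral>\<zeta>. f \<zeta> \<partial>P (s + h) \<eta>) = (\<integral>\<xi>. (\<integral>\<zeta>. f \<zeta> \<partial>P h \<xi>) \<partial>P s \<eta>)"
    unfolding eq
  proof (rule integral_bind[OF f B meas, where B' = 1])
    show "finite_measure (P s \<eta>)" by unfold_locales
    show "AE x in P s \<eta>. emeasure (P h x) (space (P h x)) \<le> ennreal 1"
      using prob_space.emeasure_space_1[OF kernel_prob_space[OF assms(2)]] space_kernel[OF assms(1,3)]
      by (intro AE_I2) simp
  qed
  show "integrable (P s \<eta>) (\<lambda>\<xi>. \<integral>\<zeta>. f \<zeta> \<partial>P h \<xi>)"
  proof (rule integrable_const_bound[of _ B])
    show "AE \<xi> in P s \<eta>. norm (\<integral>\<zeta>. f \<zeta> \<partial>P h \<xi>) \<le> B"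
      using kernel_integral_bound[OF assms(2) _ assms(4) B] space_kernel[OF assms(1,3)]
      by (intro AE_I2) simp
    show "(\<lambda>\<xi>. \<integral>\<zeta>. f \<zeta> \<partial>P h \<xi>) \<in> borel_measurable (P s \<eta>)"
      using measurable_compose[OF meas integral_measurable_subprob_algebra[OF f]] .
  qed
qed

text \<open>The generator is a limit uniform over starting configurations, so the estimate for a
  step of length \<open>h\<close> from \<open>\<xi>\<close> may be integrated against
  \<open>P s \<eta>\<close>. This is why \<open>d\<close> can be chosen independently of
  \<open>s\<close>.\<close>

lemma kernel_step:
  assumes f: "depends_on_first n f" and \<eta>: "\<eta> \<in> space configs" and "e > 0"
  shows "\<exists>d>0. \<forall>s\<ge>0. \<forall>h. 0 < h \<longrightarrow> h < d \<longrightarrow>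
    \<bar>(\<integral>\<zeta>. f \<zeta> \<partial>P (s + h) \<eta>) - (\<integral>\<zeta>. f \<zeta> \<partial>P s \<eta>)
      - h * (\<integral>\<zeta>. tasep_generator \<alpha> f \<zeta> \<partial>P s \<eta>)\<bar> \<le> e * h"
proof -
  have "uniform_limit (space configs)
          (\<lambda>h \<eta>. ((\<integral>\<zeta>. f \<zeta> \<partial>P h \<eta>) - f \<eta>) / h) (tasep_generator \<alpha> f) (at_right 0)"
    using transition depends_on_first_local[OF f] by (simp add: tasep_transition_def)
  from uniform_limitD[OF this \<open>e > 0\<close>] obtain d where d: "d > 0"
    "\<And>h \<xi>. 0 < h \<Longrightarrow> h < d \<Longrightarrow> \<xi> \<in> space configs \<Longrightarrow>
      \<bar>((\<integral>\<zeta>. f \<zeta> \<partial>P h \<xi>) - f \<xi>) / h - tasep_generator \<alpha> f \<xi>\<bar> < e"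
    unfolding eventually_at_right_field dist_real_def by auto
  show ?thesis
  proof (intro exI[of _ d] conjI allI impI \<open>d > 0\<close>)
    fix s h :: real assume s: "0 \<le> s" and h: "0 < h" "h < d"
    interpret prob_space "P s \<eta>" using s \<eta> by (intro kernel_prob_space)
    have *: "\<bar>(\<integral>\<zeta>. f \<zeta> \<partial>P h \<xi>) - f \<xi> - h * tasep_generator \<alpha> f \<xi>\<bar> \<le> e * h"
      if "\<xi> \<in> space configs" for \<xi>
    proof -
      have "(\<integral>\<zeta>. f \<zeta> \<partial>P h \<xi>) - f \<xi> - h * tasep_generator \<alpha> f \<xi>
          = (((\<integral>\<zeta>. f \<zeta> \<partial>P h \<xi>) - f \<xi>) / h - tasep_generator \<alpha> f \<xi>) * h"
        using h by (simp add: field_simps)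
      then show ?thesis using d(2)[OF h that] h by (simp add: abs_mult)
    qed
    have int: "integrable (P s \<eta>) (\<lambda>\<xi>. (\<integral>\<zeta>. f \<zeta> \<partial>P h \<xi>))" "integrable (P s \<eta>) f"
      "integrable (P s \<eta>) (tasep_generator \<alpha> f)"
      using kernel_semigroup(2)[OF s _ \<eta> f, of h] kernel_integrable[OF s \<eta>] f
        depends_on_first_generator[OF f] h by auto
    have eq: "(\<integral>\<zeta>. f \<zeta> \<partial>P (s + h) \<eta>) - (\<integral>\<zeta>. f \<zeta> \<partial>P s \<eta>)
        - h * (\<integral>\<zeta>. tasep_generator \<alpha> f \<zeta> \<partial>P s \<eta>)
      = (\<integral>\<xi>. (\<integral>\<zeta>. f \<zeta> \<partial>P h \<xi>) - f \<xi> - h * tasep_generator \<alpha> f \<xi> \<partial>P s \<eta>)"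
      using kernel_semigroup(1)[OF s _ \<eta> f, of h] h int by simp
    have "(\<integral>\<xi>. (\<integral>\<zeta>. f \<zeta> \<partial>P h \<xi>) - f \<xi> - h * tasep_generator \<alpha> f \<xi> \<partial>P s \<eta>) \<le> e * h"
      using int * space_kernel[OF s \<eta>] by (intro integral_le_const AE_I2) (auto simp: abs_le_iff)
    moreover have lower: "- (e * h) \<le> (\<integral>\<zeta>. f \<zeta> \<partial>P h \<xi>) - f \<xi> - h * tasep_generator \<alpha> f \<xi>"
      if "\<xi> \<in> space configs" for \<xi> using *[OF that] by linarith
    moreover have "- (e * h) \<le> (\<integral>\<xi>. (\<integral>\<zeta>. f \<zeta> \<partial>P h \<xi>) - f \<xi> - h * tasep_generator \<alpha> f \<xi> \<partial>P s \<eta>)"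
      using int lower space_kernel[OF s \<eta>] by (intro integral_ge_const AE_I2) auto
    ultimately show "\<bar>(\<integral>\<zeta>. f \<zeta> \<partial>P (s + h) \<eta>) - (\<integral>\<zeta>. f \<zeta> \<partial>P s \<eta>)
        - h * (\<integral>\<zeta>. tasep_generator \<alpha> f \<zeta> \<partial>P s \<eta>)\<bar> \<le> e * h"
      unfolding eq by (simp add: abs_le_iff)
  qed
qed

lemma kolmogorov_forward:
  assumes "depends_on_first n f" "\<eta> \<in> space configs" "0 \<le> s"
  shows "((\<lambda>s. \<integral>\<zeta>. f \<zeta> \<partial>P s \<eta>) has_real_derivative (\<integral>\<zeta>. tasep_generator \<alpha> f \<zeta> \<partial>P s \<eta>))
    (at s within {0..})"
proof (rule has_real_derivative_of_uniform_steps[OF kernel_step[OF assms(1,2)] _ assms(3)])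
  let ?Lf = "tasep_generator \<alpha> f"
  \<comment> \<open>The function \<open>?Lf\<close> is again local, so its expectation is continuous
    in time by the same step estimate, now with the twice applied generator as bounded
    slope.\<close>
  have Lf: "depends_on_first (n + 1) ?Lf" using depends_on_first_generator[OF assms(1)] .
  obtain B where "\<And>\<zeta>. \<zeta> \<in> space configs \<Longrightarrow> \<bar>tasep_generator \<alpha> ?Lf \<zeta>\<bar> \<le> B"
    using depends_on_first_bounded[OF depends_on_first_generator[OF Lf]] by blast
  then show "continuous_on {0..} (\<lambda>s. \<integral>\<zeta>. ?Lf \<zeta> \<partial>P s \<eta>)"
    using kernel_integral_bound[OF _ assms(2) depends_on_first_generator[OF Lf]]
    by (intro continuous_on_of_uniform_steps[OF kernel_step[OF Lf assms(2)]]) auto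
qed

end

section \<open>Decay of the particle density\<close>

lemma tasep_generator_cong:
  assumes "depends_on_first n f" "depends_on_first n g" "\<eta> \<in> space configs"
    and "\<And>\<zeta>. \<zeta> \<in> space configs \<Longrightarrow> f \<zeta> = g \<zeta>"
  shows "tasep_generator \<alpha> f \<eta> = tasep_generator \<alpha> g \<eta>"
  unfolding tasep_generator_eq[OF assms(1,3)] tasep_generator_eq[OF assms(2,3)]
  using assms(3,4) by (simp add: inject_in_configs exchange_in_configs)

text \<open>Linearity of the generator, applied to the cylinder expansion: the generator acts on
  indicators only, and the values of \<open>f\<close> remain as coefficients.\<close>

lemma tasep_generator_expand:
  assumes f: "depends_on_first n f" and \<eta>: "\<eta> \<in> space configs"
  shows "tasep_generator \<alpha> f \<eta> = (\<Sum>a\<in>truncate_config n ` space configs.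
    f a * tasep_generator \<alpha> (\<lambda>\<zeta>. of_bool (truncate_config n \<zeta> = a)) \<eta>)"
proof -
  let ?k = "\<lambda>a \<zeta>. of_bool (truncate_config n \<zeta> = a) :: real" and ?T = "truncate_config n ` space configs"
  have diff: "f \<zeta> - f \<eta> = (\<Sum>a\<in>?T. f a * (?k a \<zeta> - ?k a \<eta>))" if "\<zeta> \<in> space configs" for \<zeta>
    using depends_on_first_expand[OF f that] depends_on_first_expand[OF f \<eta>]
    by (simp add: sum_subtractf[symmetric] right_diff_distrib)
  have "tasep_generator \<alpha> f \<eta> = \<alpha> * (\<Sum>a\<in>?T. f a * (?k a (inject \<eta>) - ?k a \<eta>))
      + (\<Sum>x=1..n. \<Sum>a\<in>?T. f a * (?k a (exchange x \<eta>) - ?k a \<eta>))"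
    unfolding tasep_generator_eq[OF f \<eta>]
    using \<eta> by (intro arg_cong2[of _ _ _ _ "(+)"] arg_cong2[of _ _ _ _ "(*)"] sum.cong refl diff)
      (auto intro: inject_in_configs exchange_in_configs)
  also have "\<dots> = (\<Sum>a\<in>?T. f a * (\<alpha> * (?k a (inject \<eta>) - ?k a \<eta>)
      + (\<Sum>x=1..n. ?k a (exchange x \<eta>) - ?k a \<eta>)))"
    unfolding distrib_left sum.distrib sum_distrib_left
    by (subst sum.swap) (simp add: mult.left_commute)
  finally show ?thesis
    by (simp add: tasep_generator_eq[OF depends_on_first_of_bool_truncate \<eta>])
qed

text \<open>A Lyapunov function for particles of both colours. With the weights
  \<open>2 ^ x\<close>, a jump from \<open>x\<close> to \<open>x + 1\<close> adds exactly what the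
  particle weighed before, so the drift is at most the total weight plus the inflow at the
  boundary.\<close>

definition particle_weight :: "nat \<Rightarrow> config \<Rightarrow> real" where
  "particle_weight n \<eta> = (\<Sum>x=1..n. 2 ^ x * of_bool (\<eta> x \<noteq> \<infinity>))"

lemma depends_on_first_weight: "depends_on_first n (particle_weight n)"
  unfolding depends_on_first_def particle_weight_def by (auto intro!: sum.cong)

lemma depends_on_first_site: "1 \<le> n \<Longrightarrow> depends_on_first n (\<lambda>\<eta>. of_bool (\<eta> n \<noteq> \<infinity>))"
  unfolding depends_on_first_def by auto

lemma particle_weight_inject: "particle_weight n (inject \<eta>) - particle_weight n \<eta> \<le> 2"
proof -
  have "particle_weight n (inject \<eta>)
      \<le> (\<Sum>x=1..n. 2 ^ x * of_bool (\<eta> x \<noteq> \<infinity>) + (if x = 1 then 2 else 0))"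
    unfolding particle_weight_def by (intro sum_mono) (auto simp: inject_def)
  also have "\<dots> \<le> particle_weight n \<eta> + 2"
    by (simp add: particle_weight_def sum.distrib)
  finally show ?thesis by simp
qed

lemma particle_weight_exchange:
  assumes "x \<in> {1..n}"
  shows "particle_weight n (exchange x \<eta>) - particle_weight n \<eta> \<le> 2 ^ x * of_bool (\<eta> x \<noteq> \<infinity>)"
proof -
  \<comment> \<open>\<open>?b\<close> marks a particle at \<open>x\<close> jumping into a hole;
    swapping two particles leaves the weight unchanged.\<close>
  let ?b = "of_bool (\<eta> x < \<eta> (x + 1) \<and> \<eta> (x + 1) = \<infinity>) :: real"
  have "particle_weight n (exchange x \<eta>) \<le> (\<Sum>y=1..n. 2 ^ y * of_bool (\<eta> y \<noteq> \<infinity>)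
      - (if y = x then 2 ^ x * ?b else 0) + (if y = x + 1 then 2 ^ (x + 1) * ?b else 0))"
    unfolding particle_weight_def by (intro sum_mono) (auto simp: exchange_def)
  \<comment> \<open>Only an inequality, because for \<open>x = n\<close> the particle leaves the
    window and the gain is absent.\<close>
  also have "\<dots> \<le> particle_weight n \<eta> - 2 ^ x * ?b + 2 ^ (x + 1) * ?b"
    using assms by (simp add: particle_weight_def sum.distrib sum_subtractf)
  also have "\<dots> \<le> particle_weight n \<eta> + 2 ^ x * of_bool (\<eta> x \<noteq> \<infinity>)" by auto
  finally show ?thesis by simp
qed

lemma generator_particle_weight:
  assumes "\<eta> \<in> space configs" "0 \<le> \<alpha>"
  shows "tasep_generator \<alpha> (particle_weight n) \<eta> \<le> 2 * \<alpha> + particle_weight n \<eta>"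
proof -
  have "(\<Sum>x=1..n. particle_weight n (exchange x \<eta>) - particle_weight n \<eta>) \<le> particle_weight n \<eta>"
    by (subst (3) particle_weight_def) (intro sum_mono particle_weight_exchange)
  moreover have "\<alpha> * (particle_weight n (inject \<eta>) - particle_weight n \<eta>) \<le> \<alpha> * 2"
    using assms by (intro mult_left_mono particle_weight_inject)
  ultimately show ?thesis
    unfolding tasep_generator_eq[OF depends_on_first_weight assms(1)] by simp
qed

text \<open>A geometric sum; the point is that the bound does not depend on
  \<open>n\<close>.\<close>

lemma particle_weight_le:
  assumes "\<And>x. K < x \<Longrightarrow> \<eta> x = \<infinity>"
  shows "particle_weight n \<eta> \<le> 2 ^ (K + 1)"
proof -
  have "2 ^ x * of_bool (\<eta> x \<noteq> \<infinity>) \<le> (if x \<in> {..K} then 2 ^ x else 0 :: real)" for x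
    using assms[of x] by (cases "K < x") simp_all
  then have "particle_weight n \<eta> \<le> (\<Sum>x=1..n. if x \<in> {..K} then 2 ^ x else 0)"
    unfolding particle_weight_def by (intro sum_mono)
  also have "\<dots> = (\<Sum>x\<in>{1..n} \<inter> {..K}. 2 ^ x)"
    by (subst sum.inter_restrict) simp_all
  also have "\<dots> \<le> (\<Sum>x\<in>{..K}. 2 ^ x)" by (intro sum_mono2) auto
  also have "\<dots> \<le> 2 ^ (K + 1)"
    using sum_gp_strict[of "2::real" "K + 1"] by (simp add: lessThan_Suc_atMost)
  finally show ?thesis .
qed

context tasep_kernel
begin

text \<open>Gronwall's argument: since \<open>?u' \<le> ?u + 2 * \<alpha>\<close>, the function
  \<open>?G\<close>, built with the integrating factor \<open>exp (- s)\<close>, has nonpositive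
  derivative, and the mean value theorem gives \<open>?G t \<le> ?G 0\<close>.\<close>

lemma kernel_particle_weight:
  assumes "\<eta> \<in> space configs" "0 \<le> \<alpha>" "0 \<le> t"
  shows "(\<integral>\<zeta>. particle_weight n \<zeta> \<partial>P t \<eta>) \<le> exp t * (particle_weight n \<eta> + 2 * \<alpha>)"
proof (cases "t = 0")
  case True
  then show ?thesis using kernel_zero[OF assms(1) depends_on_first_weight] assms by simp
next
  case False
  let ?u = "\<lambda>s. \<integral>\<zeta>. particle_weight n \<zeta> \<partial>P s \<eta>"
  let ?u' = "\<lambda>s. \<integral>\<zeta>. tasep_generator \<alpha> (particle_weight n) \<zeta> \<partial>P s \<eta>"
  let ?G = "\<lambda>s. exp (- s) * (?u s + 2 * \<alpha>)"
  let ?G' = "\<lambda>s. exp (- s) * (?u' s - ?u s - 2 * \<alpha>)"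
  have deriv: "(?G has_derivative (\<lambda>h. ?G' s * h)) (at s within {0..t})" if "0 \<le> s" "s \<le> t" for s
  proof -
    have "(?u has_real_derivative ?u' s) (at s within {0..t})"
      using kolmogorov_forward[OF depends_on_first_weight assms(1) that(1)]
      by (rule DERIV_subset) auto
    then have "(?G has_real_derivative ?G' s) (at s within {0..t})"
      by (auto intro!: derivative_eq_intros simp: algebra_simps)
    then show ?thesis by (simp add: has_field_derivative_def)
  qed
  obtain s where s: "0 < s" "s < t" "?G t - ?G 0 = ?G' s * (t - 0)"
    using mvt_simple[OF _ deriv] False assms(3) by auto
  interpret prob_space "P s \<eta>" using s assms by (intro kernel_prob_space) auto
  have "?u' s \<le> (\<integral>\<zeta>. 2 * \<alpha> + particle_weight n \<zeta> \<partial>P s \<eta>)"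
  proof (rule integral_mono)
    show "tasep_generator \<alpha> (particle_weight n) \<zeta> \<le> 2 * \<alpha> + particle_weight n \<zeta>"
      if "\<zeta> \<in> space (P s \<eta>)" for \<zeta>
      using generator_particle_weight assms that s space_kernel[of s \<eta>] by simp
    show "integrable (P s \<eta>) (tasep_generator \<alpha> (particle_weight n))"
      using s assms kernel_integrable[OF _ _ depends_on_first_generator[OF depends_on_first_weight]] by simp
    show "integrable (P s \<eta>) (\<lambda>\<zeta>. 2 * \<alpha> + particle_weight n \<zeta>)"
      using s assms kernel_integrable[OF _ _ depends_on_first_weight] by simp
  qed
  also have "\<dots> = 2 * \<alpha> + ?u s"
    using s assms kernel_integrable[OF _ _ depends_on_first_weight] by (simp add: prob_space)
  finally have "?G' s * (t - 0) \<le> 0"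
    using s by (intro mult_nonpos_nonneg mult_nonneg_nonpos) auto
  then have "?G t \<le> ?G 0" using s by simp
  then have "exp t * ?G t \<le> exp t * ?G 0" by (intro mult_left_mono) auto
  moreover have "exp t * ?G t = ?u t + 2 * \<alpha>"
    by (simp add: mult.assoc[symmetric] mult_exp_exp)
  ultimately have "?u t + 2 * \<alpha> \<le> exp t * (particle_weight n \<eta> + 2 * \<alpha>)"
    using kernel_zero[OF assms(1) depends_on_first_weight] by simp
  then show ?thesis using assms by simp
qed

text \<open>Markov's inequality: a particle at \<open>n\<close> alone contributes
  \<open>2 ^ n\<close> to the weight, whose expectation is bounded uniformly in
  \<open>n\<close>.\<close>

lemma kernel_site_occupied:
  assumes "\<eta> \<in> space configs" "0 \<le> \<alpha>" "0 \<le> t" "1 \<le> n" "\<And>x. K < x \<Longrightarrow> \<eta> x = \<infinity>"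
  shows "(\<integral>\<zeta>. of_bool (\<zeta> n \<noteq> \<infinity>) \<partial>P t \<eta>) \<le> exp t * (2 ^ (K + 1) + 2 * \<alpha>) / 2 ^ n"
proof -
  have "(2 :: real) ^ n * (\<integral>\<zeta>. of_bool (\<zeta> n \<noteq> \<infinity>) \<partial>P t \<eta>) = (\<integral>\<zeta>. 2 ^ n * of_bool (\<zeta> n \<noteq> \<infinity>) \<partial>P t \<eta>)"
    by simp
  also have "\<dots> \<le> (\<integral>\<zeta>. particle_weight n \<zeta> \<partial>P t \<eta>)"
  proof (rule integral_mono)
    show "(2 :: real) ^ n * of_bool (\<zeta> n \<noteq> \<infinity>) \<le> particle_weight n \<zeta>" for \<zeta> :: config
      unfolding particle_weight_def using assms by (intro member_le_sum) auto
    show "integrable (P t \<eta>) (particle_weight n)"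
      using assms kernel_integrable[OF _ _ depends_on_first_weight] by simp
    show "integrable (P t \<eta>) (\<lambda>\<zeta>. (2 :: real) ^ n * of_bool (\<zeta> n \<noteq> \<infinity>))"
      using assms kernel_integrable[OF _ _ depends_on_first_site[OF assms(4)]] by simp
  qed
  also have "\<dots> \<le> exp t * (particle_weight n \<eta> + 2 * \<alpha>)"
    using assms by (intro kernel_particle_weight)
  also have "\<dots> \<le> exp t * (2 ^ (K + 1) + 2 * \<alpha>)"
    using particle_weight_le[of K \<eta> n] assms by (intro mult_left_mono) auto
  finally show ?thesis by (simp add: field_simps)
qed

text \<open>Borel-Cantelli: the probability that a site is occupied decays geometrically in its
  position.\<close>

lemma kernel_eventually_empty:
  assumes "\<eta> \<in> space configs" "0 \<le> \<alpha>" "0 \<le> t" "\<And>x. K < x \<Longrightarrow> \<eta> x = \<infinity>"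
  shows "AE \<zeta> in P t \<eta>. \<exists>N. \<forall>n>N. \<zeta> n = \<infinity>"
proof -
  interpret prob_space "P t \<eta>" using assms by (intro kernel_prob_space)
  \<comment> \<open>The index is shifted by one because the sites start at \<open>1\<close>.\<close>
  let ?A = "\<lambda>n. {\<zeta> \<in> space configs. \<zeta> (n + 1) \<noteq> \<infinity>}"
  note sp = space_kernel[OF assms(3,1)]
  have A: "?A n \<in> sets (P t \<eta>)" for n using sets_kernel[OF assms(3,1)] by simp
  have le: "prob (?A n) \<le> exp t * (2 ^ (K + 1) + 2 * \<alpha>) * (1 / 2) ^ n" for n
  proof -
    have "prob (?A n) = (\<integral>\<zeta>. indicator (?A n) \<zeta> \<partial>P t \<eta>)"
      using sp by (simp add: Int_absorb2 subset_eq)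
    also have "\<dots> = (\<integral>\<zeta>. of_bool (\<zeta> (n + 1) \<noteq> \<infinity>) \<partial>P t \<eta>)"
      unfolding indicator_def using sp by (intro Bochner_Integration.integral_cong refl) simp
    also have "\<dots> \<le> exp t * (2 ^ (K + 1) + 2 * \<alpha>) / 2 ^ (n + 1)"
      using assms by (intro kernel_site_occupied) auto
    also have "\<dots> \<le> exp t * (2 ^ (K + 1) + 2 * \<alpha>) / 2 ^ n"
      using assms by (intro divide_left_mono) auto
    finally show ?thesis by (simp add: power_divide)
  qed
  have "summable (\<lambda>n. prob (?A n))"
  proof (rule summable_comparison_test')
    show "summable (\<lambda>n. exp t * (2 ^ (K + 1) + 2 * \<alpha>) * (1 / 2) ^ n)"
      by (intro summable_mult summable_geometric) simp
    show "norm (prob (?A n)) \<le> exp t * (2 ^ (K + 1) + 2 * \<alpha>) * (1 / 2) ^ n" if "0 \<le> n" for n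
      using le[of n] by simp
  qed
  then have "AE \<zeta> in P t \<eta>. eventually (\<lambda>n. \<zeta> \<in> space (P t \<eta>) - ?A n) sequentially"
    using A by (intro borel_cantelli_AE1) (auto simp: less_top[symmetric])
  then show ?thesis
  proof (rule AE_mp, intro AE_I2 impI)
    fix \<zeta> assume "\<zeta> \<in> space (P t \<eta>)" "eventually (\<lambda>n. \<zeta> \<in> space (P t \<eta>) - ?A n) sequentially"
    then obtain N where N: "\<And>n. n \<ge> N \<Longrightarrow> \<zeta> (n + 1) = \<infinity>"
      using sp unfolding eventually_sequentially by auto
    have "\<zeta> n = \<infinity>" if "n > N" for n using N[of "n - 1"] that by simp
    then show "\<exists>N. \<forall>n>N. \<zeta> n = \<infinity>" by blast
  qed
qed

end

section \<open>Duality of expectations\<close>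

text \<open>The test function \<open>\<phi>\<close> of the pair
  \<open>(H\<^sub>1, H\<^sub>2)\<close> is left general, since a joint law is to be compared. The
  first argument enters through both colours, the second only through its first-class
  particles.\<close>

definition duality_fun :: "nat \<Rightarrow> (nat \<Rightarrow> nat \<Rightarrow> real) \<Rightarrow> config \<Rightarrow> config \<Rightarrow> real" where
  "duality_fun n \<phi> \<eta> \<zeta> = \<phi> (overlap n (occ n 1 \<eta>) (occ n 1 \<zeta>)) (overlap n (occ n 2 \<eta>) (occ n 1 \<zeta>))"

lemma dual_exchange: "1 \<le> x \<Longrightarrow> x < n \<Longrightarrow> duality_fun n \<phi> (exchange x \<eta>) \<zeta> = duality_fun n \<phi> \<eta> (exchange x \<zeta>)"
  by (simp add: duality_fun_def overlap_exchange)

lemma one_le_two_enat: "(1 :: enat) \<le> 2"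
  by (metis one_le_numeral)

lemma dual_inject: "1 \<le> n \<Longrightarrow> duality_fun n \<phi> (inject \<eta>) \<zeta> = duality_fun n \<phi> \<eta> (inject \<zeta>)"
  using one_le_two_enat by (simp add: duality_fun_def overlap_inject)

lemma depends_on_first_dual:
  "depends_on_first n (\<lambda>\<eta>. duality_fun n \<phi> \<eta> \<zeta>)" "depends_on_first n (duality_fun n \<phi> \<eta>)"
proof -
  have *: "occ n c \<eta> = occ n c \<eta>'" if "\<forall>x\<in>{1..n}. \<eta> x = \<eta>' x" for c \<eta> \<eta>'
    using that by (intro ext occ_cong) auto
  show "depends_on_first n (\<lambda>\<eta>. duality_fun n \<phi> \<eta> \<zeta>)" "depends_on_first n (duality_fun n \<phi> \<eta>)"
    unfolding depends_on_first_def duality_fun_def using * by (intro ballI impI, metis)+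
qed

text \<open>Injection and the bonds inside the window can be moved from one argument to the other,
  so only the bond \<open>(n, n + 1)\<close> survives in the difference. It does nothing if site
  \<open>n\<close> is a hole in both configurations; otherwise the difference is at most
  \<open>1\<close>, as \<open>\<phi>\<close> takes values in \<open>[0, 1]\<close>.\<close>

lemma generator_dual:
  assumes "\<eta> \<in> space configs" "\<zeta> \<in> space configs" "1 \<le> n"
    and \<phi>: "\<And>i j. 0 \<le> \<phi> i j" "\<And>i j. \<phi> i j \<le> 1"
  shows "\<bar>tasep_generator \<alpha> (\<lambda>\<eta>. duality_fun n \<phi> \<eta> \<zeta>) \<eta> - tasep_generator \<alpha> (duality_fun n \<phi> \<eta>) \<zeta>\<bar>
    \<le> of_bool (\<eta> n \<noteq> \<infinity>) + of_bool (\<zeta> n \<noteq> \<infinity>)"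
proof -
  let ?H = "duality_fun n \<phi>"
  have split: "{1..n} = insert n {1..<n}" using assms(3) by auto
  have "(\<Sum>x=1..n. ?H (exchange x \<eta>) \<zeta> - ?H \<eta> \<zeta>) - (\<Sum>x=1..n. ?H \<eta> (exchange x \<zeta>) - ?H \<eta> \<zeta>)
      = ?H (exchange n \<eta>) \<zeta> - ?H \<eta> (exchange n \<zeta>)"
    unfolding split by (simp add: dual_exchange)
  then have "tasep_generator \<alpha> (\<lambda>\<eta>. ?H \<eta> \<zeta>) \<eta> - tasep_generator \<alpha> (?H \<eta>) \<zeta>
      = ?H (exchange n \<eta>) \<zeta> - ?H \<eta> (exchange n \<zeta>)"
    using assms by (simp add: tasep_generator_eq[OF depends_on_first_dual(1)]
      tasep_generator_eq[OF depends_on_first_dual(2)] dual_inject)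
  moreover have "exchange n \<eta> = \<eta>" if "\<eta> n = \<infinity>" for \<eta> using that by (simp add: exchange_def)
  moreover have "\<bar>?H \<eta> \<zeta> - ?H \<eta>' \<zeta>'\<bar> \<le> 1" for \<eta> \<zeta> \<eta>' \<zeta>'
    unfolding duality_fun_def by (smt (verit, best) \<phi>)
  ultimately show ?thesis
    by (cases "\<eta> n = \<infinity>"; cases "\<zeta> n = \<infinity>") (auto intro: order_trans[of _ 1])
qed

text \<open>
  The left-hand side is the \<open>s\<close>-derivative of the expectation of \<open>H \<eta>\<^sub>s \<zeta>\<^bsub>t-s\<^esub>\<close> for independent
  \<open>\<eta>\<close> and \<open>\<zeta>\<close>. Expanding \<open>H\<close> over the finitely many truncations of its second argument makes that
  expectation a sum of products, so no joint measurability is needed.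
\<close>

lemma duality_drift_bound:
  fixes \<mu> \<nu> :: "config measure" and H :: "config \<Rightarrow> config \<Rightarrow> real"
  defines "k \<equiv> \<lambda>n a \<zeta>. of_bool (truncate_config n \<zeta> = a)"
  assumes \<mu>: "prob_space \<mu>" "sets \<mu> = sets configs" and \<nu>: "prob_space \<nu>" "sets \<nu> = sets configs"
    and H: "\<And>\<zeta>. \<zeta> \<in> space configs \<Longrightarrow> depends_on_first n (\<lambda>\<eta>. H \<eta> \<zeta>)"
      "\<And>\<eta>. \<eta> \<in> space configs \<Longrightarrow> depends_on_first n (H \<eta>)"
    and bound: "\<And>\<eta> \<zeta>. \<eta> \<in> space configs \<Longrightarrow> \<zeta> \<in> space configs \<Longrightarrow>
      \<bar>tasep_generator \<alpha> (\<lambda>\<eta>. H \<eta> \<zeta>) \<eta> - tasep_generator \<alpha> (H \<eta>) \<zeta>\<bar> \<le> g \<eta> + g \<zeta>"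
    and g: "depends_on_first n g"
  shows "\<bar>\<Sum>a\<in>truncate_config n ` space configs.
      (\<integral>\<eta>. tasep_generator \<alpha> (\<lambda>\<eta>. H \<eta> a) \<eta> \<partial>\<mu>) * (\<integral>\<zeta>. k n a \<zeta> \<partial>\<nu>)
      - (\<integral>\<eta>. H \<eta> a \<partial>\<mu>) * (\<integral>\<zeta>. tasep_generator \<alpha> (k n a) \<zeta> \<partial>\<nu>)\<bar>
    \<le> (\<integral>\<eta>. g \<eta> \<partial>\<mu>) + (\<integral>\<zeta>. g \<zeta> \<partial>\<nu>)"
proof -
  interpret \<mu>: prob_space \<mu> by fact
  interpret \<nu>: prob_space \<nu> by fact
  let ?T = "truncate_config n ` space configs"
  have sp: "space \<mu> = space configs" "space \<nu> = space configs"
    using \<mu>(2) \<nu>(2) by (auto dest: sets_eq_imp_space_eq)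
  have T: "a \<in> space configs" if "a \<in> ?T" for a using that by (auto intro: truncate_in_configs)
  have k: "depends_on_first n (k n a)" for a
    unfolding k_def by (rule depends_on_first_of_bool_truncate)
  have int\<mu>: "integrable \<mu> (\<lambda>\<eta>. H \<eta> a)" "integrable \<mu> (tasep_generator \<alpha> (\<lambda>\<eta>. H \<eta> a))" if "a \<in> ?T" for a
    using depends_on_first_integrable[OF \<mu> H(1)[OF T[OF that]]]
      depends_on_first_integrable[OF \<mu> depends_on_first_generator[OF H(1)[OF T[OF that]]]]
    by auto
  have int\<nu>: "integrable \<nu> (k n a)" "integrable \<nu> (tasep_generator \<alpha> (k n a))" for a
    using depends_on_first_integrable[OF \<nu> k]
      depends_on_first_integrable[OF \<nu> depends_on_first_generator[OF k]] by auto
  have intg: "integrable \<mu> g" "integrable \<nu> g" using depends_on_first_integrable[OF \<mu> g]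
      depends_on_first_integrable[OF \<nu> g] by auto
  \<comment> \<open>\<open>?D \<eta> \<zeta>\<close> is the difference of the two generators acting
    on \<open>H\<close>, written through the expansion in the second argument.\<close>
  let ?D = "\<lambda>\<eta> \<zeta>. \<Sum>a\<in>?T. tasep_generator \<alpha> (\<lambda>\<eta>. H \<eta> a) \<eta> * k n a \<zeta> - H \<eta> a * tasep_generator \<alpha> (k n a) \<zeta>"
  have D: "\<bar>?D \<eta> \<zeta>\<bar> \<le> g \<eta> + g \<zeta>" if \<eta>: "\<eta> \<in> space configs" and \<zeta>: "\<zeta> \<in> space configs" for \<eta> \<zeta>
  proof -
    have "(\<Sum>a\<in>?T. tasep_generator \<alpha> (\<lambda>\<eta>. H \<eta> a) \<eta> * k n a \<zeta>)
        = (\<Sum>a\<in>?T. if a = truncate_config n \<zeta> then tasep_generator \<alpha> (\<lambda>\<eta>. H \<eta> a) \<eta> else 0)"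
      unfolding k_def by (intro sum.cong) auto
    also have "\<dots> = tasep_generator \<alpha> (\<lambda>\<eta>. H \<eta> (truncate_config n \<zeta>)) \<eta>"
      using \<zeta> by (simp add: finite_truncate)
    also have "\<dots> = tasep_generator \<alpha> (\<lambda>\<eta>. H \<eta> \<zeta>) \<eta>"
      using depends_on_first_truncate[OF H(2) \<zeta>]
      by (intro tasep_generator_cong[OF H(1) H(1) \<eta>] truncate_in_configs \<zeta>)
    finally have "?D \<eta> \<zeta> = tasep_generator \<alpha> (\<lambda>\<eta>. H \<eta> \<zeta>) \<eta> - tasep_generator \<alpha> (H \<eta>) \<zeta>"
      using tasep_generator_expand[OF H(2)[OF \<eta>] \<zeta>] by (simp add: sum_subtractf k_def)
    then show ?thesis using bound[OF \<eta> \<zeta>] by simp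
  qed
  \<comment> \<open>\<open>?I\<close> is \<open>?D\<close> with \<open>\<eta>\<close> integrated
    out; the bound is carried through one integration at a time.\<close>
  let ?I = "\<lambda>\<zeta>. \<Sum>a\<in>?T. (\<integral>\<eta>. tasep_generator \<alpha> (\<lambda>\<eta>. H \<eta> a) \<eta> \<partial>\<mu>) * k n a \<zeta>
      - (\<integral>\<eta>. H \<eta> a \<partial>\<mu>) * tasep_generator \<alpha> (k n a) \<zeta>"
  have I: "\<bar>?I \<zeta>\<bar> \<le> (\<integral>\<eta>. g \<eta> \<partial>\<mu>) + g \<zeta>" if \<zeta>: "\<zeta> \<in> space configs" for \<zeta>
  proof -
    have intD: "integrable \<mu> (\<lambda>\<eta>. ?D \<eta> \<zeta>)" using int\<mu> by simp
    have eq: "?I \<zeta> = (\<integral>\<eta>. ?D \<eta> \<zeta> \<partial>\<mu>)" using int\<mu> by (simp add: Bochner_Integration.integral_sum)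
    have "\<bar>\<integral>\<eta>. ?D \<eta> \<zeta> \<partial>\<mu>\<bar> \<le> (\<integral>\<eta>. \<bar>?D \<eta> \<zeta>\<bar> \<partial>\<mu>)" by (rule integral_abs_bound)
    also have "\<dots> \<le> (\<integral>\<eta>. g \<eta> + g \<zeta> \<partial>\<mu>)"
    proof (rule integral_mono)
      show "integrable \<mu> (\<lambda>\<eta>. \<bar>?D \<eta> \<zeta>\<bar>)" using intD by (rule integrable_abs)
      show "integrable \<mu> (\<lambda>\<eta>. g \<eta> + g \<zeta>)" using intg by simp
      show "\<bar>?D \<eta> \<zeta>\<bar> \<le> g \<eta> + g \<zeta>" if "\<eta> \<in> space \<mu>" for \<eta>
        using that unfolding sp by (rule D[OF _ \<zeta>])
    qed
    also have "\<dots> = (\<integral>\<eta>. g \<eta> \<partial>\<mu>) + g \<zeta>" using intg by (simp add: \<mu>.prob_space)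
    finally show ?thesis unfolding eq .
  qed
  have intI: "integrable \<nu> ?I" using int\<nu> by simp
  have eq: "(\<Sum>a\<in>?T. (\<integral>\<eta>. tasep_generator \<alpha> (\<lambda>\<eta>. H \<eta> a) \<eta> \<partial>\<mu>) * (\<integral>\<zeta>. k n a \<zeta> \<partial>\<nu>)
      - (\<integral>\<eta>. H \<eta> a \<partial>\<mu>) * (\<integral>\<zeta>. tasep_generator \<alpha> (k n a) \<zeta> \<partial>\<nu>)) = (\<integral>\<zeta>. ?I \<zeta> \<partial>\<nu>)"
    using int\<nu> by (simp add: Bochner_Integration.integral_sum)
  have "\<bar>\<integral>\<zeta>. ?I \<zeta> \<partial>\<nu>\<bar> \<le> (\<integral>\<zeta>. \<bar>?I \<zeta>\<bar> \<partial>\<nu>)" by (rule integral_abs_bound)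
  also have "\<dots> \<le> (\<integral>\<zeta>. (\<integral>\<eta>. g \<eta> \<partial>\<mu>) + g \<zeta> \<partial>\<nu>)"
  proof (rule integral_mono)
    show "integrable \<nu> (\<lambda>\<zeta>. \<bar>?I \<zeta>\<bar>)" using intI by (rule integrable_abs)
    show "integrable \<nu> (\<lambda>\<zeta>. (\<integral>\<eta>. g \<eta> \<partial>\<mu>) + g \<zeta>)" using intg by simp
    show "\<bar>?I \<zeta>\<bar> \<le> (\<integral>\<eta>. g \<eta> \<partial>\<mu>) + g \<zeta>" if "\<zeta> \<in> space \<nu>" for \<zeta>
      using that unfolding sp by (rule I)
  qed
  also have "\<dots> = (\<integral>\<eta>. g \<eta> \<partial>\<mu>) + (\<integral>\<zeta>. g \<zeta> \<partial>\<nu>)" using intg by (simp add: \<nu>.prob_space)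
  finally show ?thesis unfolding eq .
qed

text \<open>The function \<open>\<psi>\<close> runs one copy for time \<open>s\<close> and the other
  for time \<open>t - s\<close>, and so interpolates between the two expectations. Its derivative is
  bounded by the probabilities that site \<open>n\<close> is occupied, which decay like
  \<open>1 / 2 ^ n\<close>. Two kernels appear because each process comes with its own.\<close>

lemma duality_error_bound:
  assumes "tasep_kernel \<alpha> P" "tasep_kernel \<alpha> Q" "0 \<le> \<alpha>" "0 \<le> t" "1 \<le> n"
    and \<eta>: "\<eta> \<in> space configs" "\<And>x. K < x \<Longrightarrow> \<eta> x = \<infinity>"
    and \<zeta>: "\<zeta> \<in> space configs" "\<And>x. K < x \<Longrightarrow> \<zeta> x = \<infinity>"
    and \<phi>: "\<And>i j. 0 \<le> \<phi> i j" "\<And>i j. \<phi> i j \<le> 1"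
  shows "\<bar>(\<integral>\<xi>. duality_fun n \<phi> \<xi> \<zeta> \<partial>P t \<eta>) - (\<integral>\<xi>. duality_fun n \<phi> \<eta> \<xi> \<partial>Q t \<zeta>)\<bar>
    \<le> 2 * t * exp t * (2 ^ (K + 1) + 2 * \<alpha>) / 2 ^ n"
proof (cases "t = 0")
  case True
  then show ?thesis
    using tasep_kernel.kernel_zero[OF assms(1) \<eta>(1) depends_on_first_dual(1)]
      tasep_kernel.kernel_zero[OF assms(2) \<zeta>(1) depends_on_first_dual(2)] by simp
next
  case False
  interpret P: tasep_kernel \<alpha> P by fact
  interpret Q: tasep_kernel \<alpha> Q by fact
  let ?T = "truncate_config n ` space configs" and ?k = "\<lambda>a \<xi>. of_bool (truncate_config n \<xi> = a) :: real"
  let ?g = "\<lambda>\<xi>. of_bool (\<xi> n \<noteq> \<infinity>) :: real"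
  let ?p = "\<lambda>a s. \<integral>\<xi>. duality_fun n \<phi> \<xi> a \<partial>P s \<eta>" and ?q = "\<lambda>a s. \<integral>\<xi>. ?k a \<xi> \<partial>Q s \<zeta>"
  let ?p' = "\<lambda>a s. \<integral>\<xi>. tasep_generator \<alpha> (\<lambda>\<xi>. duality_fun n \<phi> \<xi> a) \<xi> \<partial>P s \<eta>"
    and ?q' = "\<lambda>a s. \<integral>\<xi>. tasep_generator \<alpha> (?k a) \<xi> \<partial>Q s \<zeta>"
  define \<psi> where "\<psi> s = (\<Sum>a\<in>?T. ?p a s * ?q a (t - s))" for s
  let ?\<psi>' = "\<lambda>s. \<Sum>a\<in>?T. ?p' a s * ?q a (t - s) - ?p a s * ?q' a (t - s)"
  have deriv: "(\<psi> has_derivative (\<lambda>h. ?\<psi>' s * h)) (at s within {0..t})" if s: "0 \<le> s" "s \<le> t" for s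
  proof -
    have p: "(?p a has_real_derivative ?p' a s) (at s within {0..t})" for a
      using P.kolmogorov_forward[OF depends_on_first_dual(1) \<eta>(1) s(1)]
      by (rule DERIV_subset) auto
    have q: "((\<lambda>s. ?q a (t - s)) has_real_derivative (- ?q' a (t - s))) (at s within {0..t})" for a
    proof -
      have "(?q a has_real_derivative ?q' a (t - s)) (at (t - s) within (\<lambda>s. t - s) ` {0..t})"
        using Q.kolmogorov_forward[OF depends_on_first_of_bool_truncate \<zeta>(1)] s
        by (rule_tac DERIV_subset[of _ _ _ "{0..}"]) auto
      moreover have "((\<lambda>s. t - s) has_real_derivative - 1) (at s within {0..t})"
        by (auto intro!: derivative_eq_intros)
      ultimately show ?thesis using DERIV_image_chain[of "?q a" _ "\<lambda>s. t - s" s "{0..t}" "- 1"]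
        by (simp add: o_def)
    qed
    have "(\<psi> has_real_derivative ?\<psi>' s) (at s within {0..t})"
      unfolding \<psi>_def
      by (rule DERIV_sum) (auto intro!: derivative_eq_intros p q simp: algebra_simps)
    then show ?thesis by (simp add: has_field_derivative_def)
  qed
  obtain s where s: "0 < s" "s < t" "\<psi> t - \<psi> 0 = ?\<psi>' s * (t - 0)"
    using mvt_simple[OF _ deriv] False assms(4) by auto
  \<comment> \<open>The mean value point \<open>s\<close> is unknown, so a bound valid for all times
    up to \<open>t\<close> is used at both \<open>s\<close> and \<open>t - s\<close>.\<close>
  have site: "(\<integral>\<xi>. ?g \<xi> \<partial>R r \<theta>) \<le> exp t * (2 ^ (K + 1) + 2 * \<alpha>) / 2 ^ n"
    if "tasep_kernel \<alpha> R" "0 \<le> r" "r \<le> t" "\<theta> \<in> space configs" "\<And>x. K < x \<Longrightarrow> \<theta> x = \<infinity>" for R r \<theta>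
  proof -
    have "(\<integral>\<xi>. ?g \<xi> \<partial>R r \<theta>) \<le> exp r * (2 ^ (K + 1) + 2 * \<alpha>) / 2 ^ n"
      using that assms by (intro tasep_kernel.kernel_site_occupied) auto
    also have "\<dots> \<le> exp t * (2 ^ (K + 1) + 2 * \<alpha>) / 2 ^ n"
      using that assms(3) by (intro divide_right_mono mult_right_mono) auto
    finally show ?thesis .
  qed
  have "\<bar>?\<psi>' s\<bar> \<le> (\<integral>\<xi>. ?g \<xi> \<partial>P s \<eta>) + (\<integral>\<xi>. ?g \<xi> \<partial>Q (t - s) \<zeta>)"
    using s \<eta>(1) \<zeta>(1) assms(5) \<phi>
    by (intro duality_drift_bound P.kernel_prob_space Q.kernel_prob_space P.sets_kernel Q.sets_kernel
      depends_on_first_dual depends_on_first_site generator_dual) auto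
  also have "\<dots> \<le> exp t * (2 ^ (K + 1) + 2 * \<alpha>) / 2 ^ n + exp t * (2 ^ (K + 1) + 2 * \<alpha>) / 2 ^ n"
    using s by (intro add_mono site[OF assms(1) _ _ \<eta>] site[OF assms(2) _ _ \<zeta>]) auto
  also have "\<dots> = 2 * (exp t * (2 ^ (K + 1) + 2 * \<alpha>) / 2 ^ n)" by simp
  finally have "\<bar>?\<psi>' s\<bar> * t \<le> 2 * (exp t * (2 ^ (K + 1) + 2 * \<alpha>) / 2 ^ n) * t"
    using assms(4) by (rule mult_right_mono)
  moreover have "\<bar>\<psi> t - \<psi> 0\<bar> = \<bar>?\<psi>' s\<bar> * t"
    unfolding s(3) abs_mult using assms(4) by simp
  ultimately have "\<bar>\<psi> t - \<psi> 0\<bar> \<le> 2 * (exp t * (2 ^ (K + 1) + 2 * \<alpha>) / 2 ^ n) * t" by simp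
  moreover have "\<psi> t = (\<integral>\<xi>. duality_fun n \<phi> \<xi> \<zeta> \<partial>P t \<eta>)"
  proof -
    have "\<psi> t = (\<Sum>a\<in>?T. ?p a t * ?k a \<zeta>)"
      unfolding \<psi>_def using Q.kernel_zero[OF \<zeta>(1) depends_on_first_of_bool_truncate] by simp
    also have "\<dots> = (\<integral>\<xi>. (\<Sum>a\<in>?T. duality_fun n \<phi> \<xi> a * ?k a \<zeta>) \<partial>P t \<eta>)"
      using P.kernel_integrable[OF assms(4) \<eta>(1) depends_on_first_dual(1)]
      by (simp add: Bochner_Integration.integral_sum)
    also have "\<dots> = (\<integral>\<xi>. duality_fun n \<phi> \<xi> \<zeta> \<partial>P t \<eta>)"
      using depends_on_first_expand[OF depends_on_first_dual(2) \<zeta>(1)]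
      by (intro Bochner_Integration.integral_cong refl) simp
    finally show ?thesis .
  qed
  moreover have "\<psi> 0 = (\<integral>\<xi>. duality_fun n \<phi> \<eta> \<xi> \<partial>Q t \<zeta>)"
  proof -
    have "\<psi> 0 = (\<Sum>a\<in>?T. duality_fun n \<phi> \<eta> a * ?q a t)"
      unfolding \<psi>_def using P.kernel_zero[OF \<eta>(1) depends_on_first_dual(1)] by simp
    also have "\<dots> = (\<integral>\<xi>. (\<Sum>a\<in>?T. duality_fun n \<phi> \<eta> a * ?k a \<xi>) \<partial>Q t \<zeta>)"
      using Q.kernel_integrable[OF assms(4) \<zeta>(1) depends_on_first_of_bool_truncate]
      by (simp add: Bochner_Integration.integral_sum)
    also have "\<dots> = (\<integral>\<xi>. duality_fun n \<phi> \<eta> \<xi> \<partial>Q t \<zeta>)"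
      using depends_on_first_expand[OF depends_on_first_dual(2)] Q.space_kernel[OF assms(4) \<zeta>(1)]
      by (intro Bochner_Integration.integral_cong refl) simp
    finally show ?thesis .
  qed
  ultimately show ?thesis by (simp add: mult_ac)
qed

section \<open>The one-shock initial condition\<close>

lemma occ_antimono: "a \<le> b \<Longrightarrow> occ n c \<eta> b \<le> occ n c \<eta> a"
  unfolding occ_def by (intro sum_mono2) auto

text \<open>Each site passed removes at most one particle from the count.\<close>

lemma occ_plus_mono:
  assumes "a \<le> b"
  shows "occ n c \<eta> a + a \<le> occ n c \<eta> b + b"
proof -
  have "occ n c \<eta> a \<le> (\<Sum>y\<in>{b<..n} \<union> {a<..b}. of_bool (\<eta> y \<le> c))"
    unfolding occ_def by (intro sum_mono2) auto
  also have "\<dots> = occ n c \<eta> b + (\<Sum>y\<in>{a<..b}. of_bool (\<eta> y \<le> c))"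
    unfolding occ_def by (intro sum.union_disjoint) auto
  also have "\<dots> \<le> occ n c \<eta> b + (\<Sum>y\<in>{a<..b}. 1)"
    by (intro add_left_mono sum_mono) auto
  finally show ?thesis using assms by simp
qed

lemma overlap_eqI:
  assumes "\<And>b. b \<le> n \<Longrightarrow> m \<le> A b + B b + b" "b \<le> n" "A b + B b + b = m"
  shows "overlap n A B = m"
  unfolding overlap_def using assms by (intro Min_eqI) auto

text \<open>By \<open>occ_plus_mono\<close> the minimum sits at \<open>b = 0\<close>, so pairing
  with a configuration that has no counted particles returns the total count of the other
  one.\<close>

lemma overlap_zero_right: "overlap n (occ n c \<eta>) (\<lambda>_. 0) = occ n c \<eta> 0"
  using occ_plus_mono[of 0] by (intro overlap_eqI[where b = 0]) auto

lemma overlap_zero_left: "overlap n (\<lambda>_. 0) (occ n c \<eta>) = occ n c \<eta> 0"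
  by (subst overlap_commute) (rule overlap_zero_right)

lemma occ_empty_config: "c \<noteq> \<infinity> \<Longrightarrow> occ n c empty_config = (\<lambda>_. 0)"
  by (auto simp: occ_def empty_config_def)

lemma occ_one_shock_first: "occ n 1 (one_shock_config M\<^sub>1 M\<^sub>2) = (\<lambda>_. 0)"
proof -
  have "\<not> one_shock_config M\<^sub>1 M\<^sub>2 y \<le> 1" if "1 \<le> y" for y
    using that by (auto simp: one_shock_config_def one_enat_def numeral_eq_enat)
  then show ?thesis by (auto simp: occ_def)
qed

text \<open>The window contains the whole block of second-class particles; for \<open>b\<close>
  beyond the block, natural subtraction gives \<open>0\<close>.\<close>

lemma occ_one_shock_second:
  assumes "M\<^sub>1 + M\<^sub>2 + 1 \<le> n"
  shows "occ n 2 (one_shock_config M\<^sub>1 M\<^sub>2) b = M\<^sub>1 + M\<^sub>2 + 1 - max b M\<^sub>1"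
proof -
  have "occ n 2 (one_shock_config M\<^sub>1 M\<^sub>2) b
      = (\<Sum>y\<in>{b<..n}. if y \<in> {M\<^sub>1 + 1..M\<^sub>1 + M\<^sub>2 + 1} then 1 else 0)"
    unfolding occ_def by (intro sum.cong) (auto simp: one_shock_config_def)
  also have "\<dots> = card ({b<..n} \<inter> {M\<^sub>1 + 1..M\<^sub>1 + M\<^sub>2 + 1})"
    by (subst sum.inter_restrict[symmetric]) auto
  also have "{b<..n} \<inter> {M\<^sub>1 + 1..M\<^sub>1 + M\<^sub>2 + 1} = {max b M\<^sub>1<..M\<^sub>1 + M\<^sub>2 + 1}"
    using assms by auto
  finally show ?thesis by simp
qed

text \<open>Up to \<open>b = M\<^sub>1\<close> the term is
  \<open>M\<^sub>2 + 1 + b + occ n 1 \<zeta> b\<close>, which is nondecreasing; across the block it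
  is \<open>?K + occ n 1 \<zeta> b\<close>, which is nonincreasing; beyond the block it is
  nondecreasing again. The minimum is therefore attained at \<open>0\<close> or at the end
  \<open>?K\<close> of the block.\<close>

lemma overlap_one_shock:
  assumes "M\<^sub>1 + M\<^sub>2 + 1 \<le> n"
  shows "overlap n (occ n 2 (one_shock_config M\<^sub>1 M\<^sub>2)) (occ n 1 \<zeta>)
    = min (M\<^sub>2 + 1 + occ n 1 \<zeta> 0) (M\<^sub>1 + M\<^sub>2 + 1 + occ n 1 \<zeta> (M\<^sub>1 + M\<^sub>2 + 1))"
    (is "_ = min ?l (?K + _)")
proof -
  let ?f = "\<lambda>b. occ n 2 (one_shock_config M\<^sub>1 M\<^sub>2) b + occ n 1 \<zeta> b + b"
  have le: "min ?l (?K + occ n 1 \<zeta> ?K) \<le> ?f b" for b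
  proof -
    consider "b \<le> M\<^sub>1" | "M\<^sub>1 < b" "b \<le> ?K" | "?K < b" by linarith
    then show ?thesis
    proof cases
      case 1
      then show ?thesis
        using occ_plus_mono[of 0 b n 1 \<zeta>] by (simp add: occ_one_shock_second[OF assms] max_def)
    next
      case 2
      then show ?thesis
        using occ_antimono[of b ?K n 1 \<zeta>] by (simp add: occ_one_shock_second[OF assms] max_def)
    next
      case 3
      then show ?thesis
        using occ_plus_mono[of ?K b n 1 \<zeta>] by (simp add: occ_one_shock_second[OF assms] max_def)
    qed
  qed
  have attained: "?f 0 = ?l" "?f ?K = ?K + occ n 1 \<zeta> ?K"
    by (simp_all add: occ_one_shock_second[OF assms])
  show ?thesis
  proof (cases "?l \<le> ?K + occ n 1 \<zeta> ?K")
    case True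
    then show ?thesis using attained(1) by (intro overlap_eqI[OF le, where b = 0]) simp_all
  next
    case False
    then show ?thesis using attained(2) assms by (intro overlap_eqI[OF le, where b = ?K]) simp_all
  qed
qed

text \<open>Once the window reaches past the last particle, the cut-off counts are exact. The shift
  to \<open>b + 1\<close> turns sites \<open>> b\<close> into sites
  \<open>\<ge> b + 1\<close>.\<close>

lemma occ_num_particles:
  assumes "\<eta> \<in> space configs" "\<And>x. N < x \<Longrightarrow> \<eta> x = \<infinity>" "N \<le> n"
  shows "occ n 1 \<eta> b = num_particles 1 (b + 1) \<eta>"
    and "occ n 2 \<eta> b = num_particles 1 (b + 1) \<eta> + num_particles 2 (b + 1) \<eta>"
proof -
  have card: "occ n c \<eta> b = card {y \<in> {1..}. b + 1 \<le> y \<and> \<eta> y \<le> c}" if "c \<noteq> \<infinity>" for c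
  proof -
    have "y \<le> n" if "\<eta> y \<le> c" for y
      using assms(2)[of y] assms(3) that \<open>c \<noteq> \<infinity>\<close> by (cases "N < y") simp_all
    then have "{b<..n} \<inter> {y. \<eta> y \<le> c} = {y \<in> {1..}. b + 1 \<le> y \<and> \<eta> y \<le> c}" by auto
    moreover have "occ n c \<eta> b = card ({b<..n} \<inter> {y. \<eta> y \<le> c})" by (simp add: occ_def)
    ultimately show ?thesis by simp
  qed
  have le: "\<eta> y \<le> 1 \<longleftrightarrow> \<eta> y = 1" "\<eta> y \<le> 2 \<longleftrightarrow> \<eta> y = 1 \<or> \<eta> y = 2" if "1 \<le> y" for y
    using config_values[OF assms(1) that] by (elim disjE; simp add: one_enat_def numeral_eq_enat)+
  have "{y \<in> {1..}. b + 1 \<le> y \<and> \<eta> y \<le> 1} = {y \<in> {1..}. b + 1 \<le> y \<and> \<eta> y = 1}"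
    by (intro Collect_cong conj_cong) (simp_all add: le)
  then show "occ n 1 \<eta> b = num_particles 1 (b + 1) \<eta>"
    unfolding num_particles_def by (simp add: card)
  have fin: "finite {y \<in> {1..}. b + 1 \<le> y \<and> \<eta> y = c}" if "c \<noteq> \<infinity>" for c
  proof (rule finite_subset[of _ "{..N}"])
    have "y \<le> N" if "\<eta> y = c" for y
      using assms(2)[of y] that \<open>c \<noteq> \<infinity>\<close> by (cases "N < y") simp_all
    then show "{y \<in> {1..}. b + 1 \<le> y \<and> \<eta> y = c} \<subseteq> {..N}" by auto
  qed simp
  have "{y \<in> {1..}. b + 1 \<le> y \<and> \<eta> y \<le> 2}
      = {y \<in> {1..}. b + 1 \<le> y \<and> \<eta> y = 1} \<union> {y \<in> {1..}. b + 1 \<le> y \<and> \<eta> y = 2}"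
    by (auto simp: le)
  then have "occ n 2 \<eta> b = card ({y \<in> {1..}. b + 1 \<le> y \<and> \<eta> y = 1} \<union> {y \<in> {1..}. b + 1 \<le> y \<and> \<eta> y = 2})"
    by (simp add: card)
  also have "\<dots> = num_particles 1 (b + 1) \<eta> + num_particles 2 (b + 1) \<eta>"
    unfolding num_particles_def by (intro card_Un_disjoint fin) (auto simp: one_enat_def numeral_eq_enat)
  finally show "occ n 2 \<eta> b = num_particles 1 (b + 1) \<eta> + num_particles 2 (b + 1) \<eta>" .
qed

section \<open>Passage from finite windows to the half-line\<close>

lemma num_particles_measurable [measurable]:
  "num_particles c x \<in> configs \<rightarrow>\<^sub>M count_space UNIV"
  unfolding num_particles_def
proof (rule measurable_card)
  fix y
  show "{\<eta> \<in> space configs. y \<in> {y \<in> {1..}. x \<le> y \<and> \<eta> y = c}} \<in> sets configs"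
    by (cases "1 \<le> y \<and> x \<le> y") auto
qed

lemma empty_config_in_configs: "empty_config \<in> space configs"
  unfolding in_configs_iff empty_config_def by simp

lemma one_shock_config_in_configs: "one_shock_config M\<^sub>1 M\<^sub>2 \<in> space configs"
  unfolding in_configs_iff one_shock_config_def by simp

text \<open>Almost surely the configuration is empty beyond some site, so \<open>f n \<zeta>\<close>
  is eventually equal to \<open>g \<zeta>\<close>, and dominated convergence applies. The index
  \<open>m\<close> lets the identification wait until the window contains the initial block.\<close>

lemma (in tasep_kernel) kernel_integral_tendsto:
  assumes "\<eta> \<in> space configs" "0 \<le> \<alpha>" "0 \<le> t" "\<And>x. K < x \<Longrightarrow> \<eta> x = \<infinity>"
    and f: "\<And>n. depends_on_first n (f n)" "\<And>n \<zeta>. \<bar>f n \<zeta>\<bar> \<le> 1" and g: "g \<in> borel_measurable configs"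
    and eq: "\<And>\<zeta> N n. \<zeta> \<in> space configs \<Longrightarrow> (\<And>x. N < x \<Longrightarrow> \<zeta> x = \<infinity>) \<Longrightarrow> N \<le> n \<Longrightarrow> m \<le> n \<Longrightarrow> f n \<zeta> = g \<zeta>"
  shows "(\<lambda>n. \<integral>\<zeta>. f n \<zeta> \<partial>P t \<eta>) \<longlonglongrightarrow> (\<integral>\<zeta>. g \<zeta> \<partial>P t \<eta>)"
proof -
  interpret prob_space "P t \<eta>" using assms by (intro kernel_prob_space)
  show ?thesis
  proof (rule integral_dominated_convergence[where w = "\<lambda>_. 1"])
    show "AE \<zeta> in P t \<eta>. (\<lambda>n. f n \<zeta>) \<longlonglongrightarrow> g \<zeta>"
    proof (rule AE_mp[OF kernel_eventually_empty[OF assms(1-3), where K = K]],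
        rule assms(4), assumption, intro AE_I2 impI)
      fix \<zeta> assume "\<zeta> \<in> space (P t \<eta>)" "\<exists>N. \<forall>n>N. \<zeta> n = \<infinity>"
      then obtain N where "\<zeta> \<in> space configs" "\<And>x. N < x \<Longrightarrow> \<zeta> x = \<infinity>"
        using space_kernel[OF assms(3,1)] by auto
      then have "f n \<zeta> = g \<zeta>" if "max N m \<le> n" for n
        using that by (intro eq[of \<zeta> N]) auto
      then have "eventually (\<lambda>n. f n \<zeta> = g \<zeta>) sequentially"
        by (rule eventually_sequentiallyI)
      then show "(\<lambda>n. f n \<zeta>) \<longlonglongrightarrow> g \<zeta>" by (rule tendsto_eventually)
    qed
    show "g \<in> borel_measurable (P t \<eta>)"
      using g sets_kernel[OF assms(3,1)] by (simp cong: measurable_cong_sets)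
    show "f n \<in> borel_measurable (P t \<eta>)" for n
      using depends_on_first_measurable[OF f(1)] sets_kernel[OF assms(3,1)]
      by (simp cong: measurable_cong_sets)
  qed (use f(2) in auto)
qed

text \<open>The limit \<open>n \<rightarrow> \<infinity>\<close> of
  \<open>duality_error_bound\<close> for the one-shock and the empty initial configuration: the
  error vanishes, and on each side the duality function becomes the indicator of the event in
  question.\<close>

lemma one_shock_duality:
  assumes P: "tasep_kernel \<alpha> P" and Q: "tasep_kernel \<alpha> Q" and "0 \<le> \<alpha>" "0 \<le> t"
  shows "measure (P t (one_shock_config M\<^sub>1 M\<^sub>2))
      {\<zeta> \<in> space configs. (int (num_particles 1 1 \<zeta>), int (num_particles 2 1 \<zeta>)) \<in> B}
    = measure (Q t empty_config) {\<zeta> \<in> space configs. (int (num_particles 1 1 \<zeta>),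
         min (int M\<^sub>1 + int M\<^sub>2 + 1 - int (num_particles 1 1 \<zeta>) + int (num_particles 1 (M\<^sub>1 + M\<^sub>2 + 2) \<zeta>))
           (int M\<^sub>2 + 1)) \<in> B}"
    (is "measure (P t ?\<eta>) ?A = measure (Q t ?e) ?A'")
proof -
  interpret P: tasep_kernel \<alpha> P by fact
  interpret Q: tasep_kernel \<alpha> Q by fact
  let ?K = "M\<^sub>1 + M\<^sub>2 + 1"
  \<comment> \<open>The duality yields the number of first-class particles and the number of all
    particles; the difference recovers the second-class ones. It is taken in \<open>int\<close>,
    where subtraction is not cut off at \<open>0\<close>.\<close>
  define \<phi> :: "nat \<Rightarrow> nat \<Rightarrow> real" where "\<phi> i j = indicator B (int i, int j - int i)" for i j
  note inP = one_shock_config_in_configs[of M\<^sub>1 M\<^sub>2] and inQ = empty_config_in_configs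
  have \<phi>: "0 \<le> \<phi> i j" "\<phi> i j \<le> 1" for i j by (auto simp: \<phi>_def indicator_def)
  have \<eta>: "?\<eta> x = \<infinity>" if "?K < x" for x using that by (simp add: one_shock_config_def)
  have e: "?e x = \<infinity>" if "?K < x" for x using that by (simp add: empty_config_def)
  have "(\<lambda>n. \<integral>\<xi>. duality_fun n \<phi> \<xi> ?e \<partial>P t ?\<eta>) \<longlonglongrightarrow> (\<integral>\<xi>. indicator ?A \<xi> \<partial>P t ?\<eta>)"
  proof (rule P.kernel_integral_tendsto[OF inP assms(3,4), where K = ?K])
    show "?\<eta> x = \<infinity>" if "?K < x" for x using that by (rule \<eta>)
    show "depends_on_first n (\<lambda>\<xi>. duality_fun n \<phi> \<xi> ?e)" for n by (rule depends_on_first_dual)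
    show "\<bar>duality_fun n \<phi> \<xi> ?e\<bar> \<le> 1" for n \<xi> using \<phi> by (simp add: duality_fun_def)
    show "(indicator ?A :: _ \<Rightarrow> real) \<in> borel_measurable configs" by measurable
    show "duality_fun n \<phi> \<xi> ?e = indicator ?A \<xi>"
      if "\<xi> \<in> space configs" "\<And>x. N < x \<Longrightarrow> \<xi> x = \<infinity>" "N \<le> n" for \<xi> N n
      using occ_num_particles[OF that, of 0] that(1)
      by (simp add: duality_fun_def occ_empty_config overlap_zero_right \<phi>_def indicator_def)
  qed
  moreover have "(\<lambda>n. \<integral>\<xi>. duality_fun n \<phi> ?\<eta> \<xi> \<partial>Q t ?e) \<longlonglongrightarrow> (\<integral>\<xi>. indicator ?A' \<xi> \<partial>Q t ?e)"
  proof (rule Q.kernel_integral_tendsto[OF inQ assms(3,4), where K = ?K and m = ?K])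
    show "?e x = \<infinity>" if "?K < x" for x using that by (rule e)
    show "depends_on_first n (duality_fun n \<phi> ?\<eta>)" for n by (rule depends_on_first_dual)
    show "\<bar>duality_fun n \<phi> ?\<eta> \<xi>\<bar> \<le> 1" for n \<xi> using \<phi> by (simp add: duality_fun_def)
    show "(indicator ?A' :: _ \<Rightarrow> real) \<in> borel_measurable configs" by measurable
    show "duality_fun n \<phi> ?\<eta> \<xi> = indicator ?A' \<xi>"
      if \<xi>: "\<xi> \<in> space configs" "\<And>x. N < x \<Longrightarrow> \<xi> x = \<infinity>" "N \<le> n" and "?K \<le> n" for \<xi> N n
    proof -
      \<comment> \<open>Here \<open>a\<close> and \<open>b\<close> stand for the numbers of
        particles at sites \<open>\<ge> 1\<close> and
        \<open>\<ge> M\<^sub>1 + M\<^sub>2 + 2\<close>; subtracting \<open>a\<close> from the value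
        in \<open>overlap_one_shock\<close> gives the formula of the theorem.\<close>
      have "int (min (M\<^sub>2 + 1 + a) (?K + b)) - int a = min (int M\<^sub>1 + int M\<^sub>2 + 1 - int a + int b) (int M\<^sub>2 + 1)"
        for a b :: nat by (simp add: min_def)
      then show ?thesis
        using occ_num_particles(1)[OF \<xi>, of 0] occ_num_particles(1)[OF \<xi>, of ?K] \<xi>(1) \<open>?K \<le> n\<close>
        by (simp add: duality_fun_def occ_one_shock_first overlap_zero_left overlap_one_shock \<phi>_def indicator_def)
    qed
  qed
  moreover have "(\<lambda>n. (\<integral>\<xi>. duality_fun n \<phi> \<xi> ?e \<partial>P t ?\<eta>) - (\<integral>\<xi>. duality_fun n \<phi> ?\<eta> \<xi> \<partial>Q t ?e)) \<longlonglongrightarrow> 0"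
  proof (rule Lim_null_comparison)
    show "\<forall>\<^sub>F n in sequentially. norm ((\<integral>\<xi>. duality_fun n \<phi> \<xi> ?e \<partial>P t ?\<eta>) - (\<integral>\<xi>. duality_fun n \<phi> ?\<eta> \<xi> \<partial>Q t ?e))
        \<le> 2 * t * exp t * (2 ^ (?K + 1) + 2 * \<alpha>) * (1 / 2) ^ n"
    proof (rule eventually_sequentiallyI[of 1])
      fix n :: nat assume "1 \<le> n"
      with P Q assms(3,4) inP inQ \<eta> e \<phi>
      have "\<bar>(\<integral>\<xi>. duality_fun n \<phi> \<xi> ?e \<partial>P t ?\<eta>) - (\<integral>\<xi>. duality_fun n \<phi> ?\<eta> \<xi> \<partial>Q t ?e)\<bar>
          \<le> 2 * t * exp t * (2 ^ (?K + 1) + 2 * \<alpha>) / 2 ^ n"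
        by (intro duality_error_bound)
      then show "norm ((\<integral>\<xi>. duality_fun n \<phi> \<xi> ?e \<partial>P t ?\<eta>) - (\<integral>\<xi>. duality_fun n \<phi> ?\<eta> \<xi> \<partial>Q t ?e))
          \<le> 2 * t * exp t * (2 ^ (?K + 1) + 2 * \<alpha>) * (1 / 2) ^ n"
        by (simp add: power_divide)
    qed
    show "(\<lambda>n. 2 * t * exp t * (2 ^ (?K + 1) + 2 * \<alpha>) * (1 / 2) ^ n) \<longlonglongrightarrow> 0"
      by (intro tendsto_mult_right_zero LIMSEQ_power_zero) simp
  qed
  ultimately have "(\<integral>\<xi>. indicator ?A \<xi> \<partial>P t ?\<eta>) - (\<integral>\<xi>. indicator ?A' \<xi> \<partial>Q t ?e) = (0 :: real)"
    by (intro LIMSEQ_unique[OF tendsto_diff])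
  moreover have "?A \<subseteq> space (P t ?\<eta>)" "?A' \<subseteq> space (Q t ?e)"
    using P.space_kernel[OF assms(4) inP] Q.space_kernel[OF assms(4) inQ] by auto
  ultimately show ?thesis by (simp add: Int_absorb2)
qed

section \<open>One-time marginals of the process\<close>

lemma subalgebra_history:
  assumes "\<And>u. 0 \<le> u \<Longrightarrow> X u \<in> M \<rightarrow>\<^sub>M configs"
  shows "subalgebra M (history M X s)"
proof -
  let ?G = "{X u -` A \<inter> space M | u A. 0 \<le> u \<and> u \<le> s \<and> A \<in> sets configs}"
  have G: "?G \<subseteq> sets M" using assms by (auto intro: measurable_sets)
  then have "?G \<subseteq> Pow (space M)" using sets.space_closed by blast
  then show ?thesis
    using sets.sigma_sets_subset[OF G] by (simp add: subalgebra_def history_def)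
qed

text \<open>The Markov property at time \<open>0\<close> and the deterministic start make the
  conditional probability of \<open>A\<close> almost surely the constant
  \<open>measure (P t \<eta>) A\<close>; taking expectations identifies the law. The kernel is
  obtained from the definition of the process.\<close>

lemma half_line_tasep_distr:
  assumes X: "half_line_tasep \<alpha> \<eta> M X" and \<eta>: "\<eta> \<in> space configs" and t: "0 \<le> t"
  obtains P where "tasep_kernel \<alpha> P" "distr M configs (X t) = P t \<eta>"
proof -
  interpret prob_space M using X by (simp add: half_line_tasep_def)
  have meas: "X u \<in> M \<rightarrow>\<^sub>M configs" if "0 \<le> u" for u
    using X that by (simp add: half_line_tasep_def)
  have init: "AE \<omega> in M. X 0 \<omega> = \<eta>" using X by (simp add: half_line_tasep_def)
  obtain P where P: "tasep_transition \<alpha> P"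
    and all: "\<forall>s\<ge>0. \<forall>t\<ge>0. \<forall>A\<in>sets configs. AE \<omega> in M.
      real_cond_exp M (history M X s) (indicator (X (s + t) -` A \<inter> space M)) \<omega> = measure (P t (X s \<omega>)) A"
    using X unfolding half_line_tasep_def by (elim conjE exE)
  have markov: "AE \<omega> in M. real_cond_exp M (history M X 0) (indicator (X t -` A \<inter> space M)) \<omega>
      = measure (P t (X 0 \<omega>)) A" if "A \<in> sets configs" for A
    using all[rule_format, OF order_refl t that] by simp
  interpret P: tasep_kernel \<alpha> P by unfold_locales fact
  interpret Pt: prob_space "P t \<eta>" using t \<eta> by (rule P.kernel_prob_space)
  interpret finite_measure_subalgebra M "history M X 0"
    by unfold_locales (intro subalgebra_history meas)
  have "distr M configs (X t) = P t \<eta>"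
  proof (rule measure_eqI)
    show "sets (distr M configs (X t)) = sets (P t \<eta>)" using P.sets_kernel[OF t \<eta>] by simp
    fix A assume "A \<in> sets (distr M configs (X t))"
    then have A: "A \<in> sets configs" by simp
    let ?A = "X t -` A \<inter> space M"
    have A': "?A \<in> sets M" using meas[OF t] A by (rule measurable_sets)
    have "prob ?A = (\<integral>\<omega>. indicator ?A \<omega> \<partial>M)" using A' by simp
    also have "\<dots> = (\<integral>\<omega>. real_cond_exp M (history M X 0) (indicator ?A) \<omega> \<partial>M)"
      using A' by (intro real_cond_exp_int(2)[symmetric]) (simp add: less_top[symmetric])
    also have "\<dots> = (\<integral>\<omega>. measure (P t \<eta>) A \<partial>M)"
    proof (rule integral_cong_AE)
      show "AE \<omega> in M. real_cond_exp M (history M X 0) (indicator ?A) \<omega> = measure (P t \<eta>) A"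
        using markov[OF A] init by eventually_elim simp
    qed auto
    finally have "prob ?A = measure (P t \<eta>) A" by (simp add: prob_space)
    then show "emeasure (distr M configs (X t)) A = emeasure (P t \<eta>) A"
      using meas[OF t] A by (simp add: emeasure_distr emeasure_eq_measure Pt.emeasure_eq_measure)
  qed
  with P.tasep_kernel_axioms show ?thesis by (rule that)
qed

theorem theorem3p4:
  fixes M\<^sub>1 M\<^sub>2 :: nat and \<alpha> t :: real
    and M :: "'a measure" and X :: "real \<Rightarrow> 'a \<Rightarrow> config"
    and M' :: "'b measure" and Y :: "real \<Rightarrow> 'b \<Rightarrow> config"
  assumes "M\<^sub>1 > 0" "M\<^sub>2 > 0" "\<alpha> > 0" "t \<ge> 0"
    and "half_line_tasep \<alpha> (one_shock_config M\<^sub>1 M\<^sub>2) M X"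
    and "half_line_tasep \<alpha> empty_config M' Y"
  shows "distr M (count_space UNIV)
           (\<lambda>\<omega>. (int (num_particles 1 1 (X t \<omega>)), int (num_particles 2 1 (X t \<omega>))))
       = distr M' (count_space UNIV)
           (\<lambda>\<omega>. (int (num_particles 1 1 (Y t \<omega>)),
                 min (int M\<^sub>1 + int M\<^sub>2 + 1 - int (num_particles 1 1 (Y t \<omega>))
                        + int (num_particles 1 (M\<^sub>1 + M\<^sub>2 + 2) (Y t \<omega>)))
                     (int M\<^sub>2 + 1)))"
proof -
  let ?F = "\<lambda>\<zeta>. (int (num_particles 1 1 \<zeta>), int (num_particles 2 1 \<zeta>))"
  let ?G = "\<lambda>\<zeta>. (int (num_particles 1 1 \<zeta>),
    min (int M\<^sub>1 + int M\<^sub>2 + 1 - int (num_particles 1 1 \<zeta>) + int (num_particles 1 (M\<^sub>1 + M\<^sub>2 + 2) \<zeta>))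
      (int M\<^sub>2 + 1))"
  let ?\<eta> = "one_shock_config M\<^sub>1 M\<^sub>2"
  note inP = one_shock_config_in_configs[of M\<^sub>1 M\<^sub>2] and inQ = empty_config_in_configs
  have X: "X t \<in> M \<rightarrow>\<^sub>M configs" and Y: "Y t \<in> M' \<rightarrow>\<^sub>M configs"
    using assms by (auto simp: half_line_tasep_def)
  have F: "?F \<in> configs \<rightarrow>\<^sub>M count_space UNIV" and G: "?G \<in> configs \<rightarrow>\<^sub>M count_space UNIV"
    by measurable
  obtain P where P: "tasep_kernel \<alpha> P" "distr M configs (X t) = P t ?\<eta>"
    using half_line_tasep_distr[OF assms(5) inP assms(4)] .
  obtain Q where Q: "tasep_kernel \<alpha> Q" "distr M' configs (Y t) = Q t empty_config"
    using half_line_tasep_distr[OF assms(6) inQ assms(4)] .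
  interpret P: prob_space "P t ?\<eta>"
    using tasep_kernel.kernel_prob_space[OF P(1) assms(4) inP] .
  interpret Q: prob_space "Q t empty_config"
    using tasep_kernel.kernel_prob_space[OF Q(1) assms(4) inQ] .
  note setsP = tasep_kernel.sets_kernel[OF P(1) assms(4) inP]
    and setsQ = tasep_kernel.sets_kernel[OF Q(1) assms(4) inQ]
  \<comment> \<open>Every subset of \<open>int \<times> int\<close> is measurable here, so the
    images of the two kernel measures are compared on arbitrary \<open>B\<close>.\<close>
  have "distr (P t ?\<eta>) (count_space UNIV) ?F = distr (Q t empty_config) (count_space UNIV) ?G"
  proof (rule measure_eqI)
    fix B :: "(int \<times> int) set"
    have "measure (P t ?\<eta>) (?F -` B \<inter> space configs) = measure (Q t empty_config) (?G -` B \<inter> space configs)"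
      using one_shock_duality[OF P(1) Q(1) _ assms(4), of M\<^sub>1 M\<^sub>2 B] assms(3)
      by (simp add: vimage_def Int_def conj_commute)
    then show "emeasure (distr (P t ?\<eta>) (count_space UNIV) ?F) B
        = emeasure (distr (Q t empty_config) (count_space UNIV) ?G) B"
      using F G setsP setsQ sets_eq_imp_space_eq[OF setsP] sets_eq_imp_space_eq[OF setsQ]
      by (simp add: emeasure_distr P.emeasure_eq_measure Q.emeasure_eq_measure cong: measurable_cong_sets)
  qed simp
  moreover have "distr (P t ?\<eta>) (count_space UNIV) ?F = distr M (count_space UNIV) (\<lambda>\<omega>. ?F (X t \<omega>))"
    unfolding P(2)[symmetric] distr_distr[OF F X] by (simp add: o_def)
  moreover have "distr (Q t empty_config) (count_space UNIV) ?G = distr M' (count_space UNIV) (\<lambda>\<omega>. ?G (Y t \<omega>))"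
    unfolding Q(2)[symmetric] distr_distr[OF G Y] by (simp add: o_def)
  ultimately show ?thesis by simp
qed

end
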